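(* Let $n \ge 1$, let $A \in \mathbb{R}^{n \times n}$ and $c \in \mathbb{R}^n$, and consider the Filippov system on $\mathbb{R}^n$ $$\dot{x} = F(x) = \begin{cases} A x, & x_1 < 0, \\ c, & x_1 > 0. \end{cases}$$ The equilibrium $x = \mathbf{0}$ of this system is exponentially stable if and only if it is asymptotically stable.
   Context: $\|\cdot\|$ is a norm on $\mathbb{R}^n$, $\mathbf{0}$ is the origin, $x_1$ denotes the first component of $x$, and $B_\delta(x) = \{y \in \mathbb{R}^n : \|x-y\| < \delta\}$. For the system $\dot{x} = F(x)$ define the set-valued function $\mathcal{F}(x) = \bigcap_{\delta>0} \mathrm{co}[F(B_\delta(x) \setminus \{x_1 = 0\})]$, where $\mathrm{co}[U]$ is the smallest closed convex set containing $U$; explicitly $$\mathcal{F}(x) = \begin{cases} \{A x\}, & x_1 < 0, \\ \{(1-\lambda) A x + \lambda c : 0 \le \lambda \le 1\}, & x_1 = 0, \\ \{c\}, & x_1 > 0. \end{cases}$$ An absolutely continuous function $\phi : [a,b] \to \mathbb{R}^n$ is a Filippov solution if $\dot\phi(t) \in \mathcal{F}(\phi(t))$ for almost all $t \in [a,b]$; on an unbounded interval, a Filippov solution is a function whose restriction to each compact subinterval is a Filippov solution. A point $x^*$ is an equilibrium if the constant function $\phi(t) = x^*$ is a Filippov solution for all $t \in \mathbb{R}$. An equilibrium $x^*$ is: (1) Lyapunov stable if for all $\varepsilon > 0$ there exists $\delta > 0$ such that every Filippov solution $\phi(t)$ with $\phi(0) \in B_\delta(x^* )$ has $\phi(t)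 \in B_\varepsilon(x^* )$ for all $t \ge 0$; (2) asymptotically stable if it is Lyapunov stable and there exists $\delta > 0$ such that every Filippov solution $\phi(t)$ with $\phi(0) \in B_\delta(x^* )$ has $\phi(t) \to x^*$ as $t \to \infty$; (3) exponentially stable if there exist $\alpha \ge 1$, $\beta > 0$ and $\delta > 0$ such that every Filippov solution $\phi(t)$ with $\phi(0) \in B_\delta(x^* )$ has $\|\phi(t) - x^*\| \le \alpha e^{-\beta t}\|\phi(0) - x^*\|$ for all $t \ge 0$. (Here solutions are understood to be maximally extended forward in time, and the requirements include that they are defined for all $t \ge 0$.) *)

theory Defs
  imports "HOL-Analysis.Analysis"
begin

definition is_norm :: "('a::real_vector \<Rightarrow> real) \<Rightarrow> bool" where
  "is_norm N \<longleftrightarrow>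
     (\<forall>x. 0 \<le> N x) \<and> (\<forall>x. N x = 0 \<longleftrightarrow> x = 0) \<and>
     (\<forall>r x. N (r *\<^sub>R x) = \<bar>r\<bar> * N x) \<and> (\<forall>x y. N (x + y) \<le> N x + N y)"

definition norm_ball :: "('a::real_vector \<Rightarrow> real) \<Rightarrow> 'a \<Rightarrow> real \<Rightarrow> 'a set" where
  "norm_ball N x \<delta> = {y. N (x - y) < \<delta>}"

text \<open>
  The vector field is undefined on the switching manifold, where the i-th component vanishes;
  the value it is given there below is irrelevant, since the Filippov set-valued map omits it.
\<close>

definition pws_field :: "'n \<Rightarrow> real^'n^'n \<Rightarrow> real^'n \<Rightarrow> real^'n \<Rightarrow> real^'n" where
  "pws_field i A c x = (if x $ i < 0 then A *v x else c)"

definition filippov_map ::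
  "(real^'n \<Rightarrow> real) \<Rightarrow> 'n \<Rightarrow> (real^'n \<Rightarrow> real^'n) \<Rightarrow> real^'n \<Rightarrow> (real^'n) set" where
  "filippov_map N i F x =
     (\<Inter>\<delta>\<in>{0<..}. (\<lambda>S. closed S \<and> convex S) hull (F ` (norm_ball N x \<delta> - {y. y $ i = 0})))"

text \<open>
  The finite families of non-overlapping subintervals of \<open>[a, b]\<close> in the usual definition of
  absolute continuity are the divisions of subsets of \<open>[a, b]\<close>.
\<close>

definition abs_continuous_on :: "real \<Rightarrow> real \<Rightarrow> (real \<Rightarrow> 'a::real_normed_vector) \<Rightarrow> bool" where
  "abs_continuous_on a b \<phi> \<longleftrightarrow>
     (\<forall>\<epsilon>>0. \<exists>\<delta>>0. \<forall>D T. D division_of T \<and> T \<subseteq> {a..b} \<and> (\<Sum>k\<in>D. Sup k - Inf k) < \<delta> \<longrightarrow>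
        (\<Sum>k\<in>D. norm (\<phi> (Sup k) - \<phi> (Inf k))) < \<epsilon>)"

definition inclusion_solution_compact ::
  "('a::real_normed_vector \<Rightarrow> 'a set) \<Rightarrow> real \<Rightarrow> real \<Rightarrow> (real \<Rightarrow> 'a) \<Rightarrow> bool" where
  "inclusion_solution_compact G a b \<phi> \<longleftrightarrow>
     abs_continuous_on a b \<phi> \<and>
     (AE t in lebesgue_on {a..b}.
        \<exists>v\<in>G (\<phi> t). (\<phi> has_vector_derivative v) (at t within {a..b}))"

definition inclusion_solution ::
  "('a::real_normed_vector \<Rightarrow> 'a set) \<Rightarrow> real set \<Rightarrow> (real \<Rightarrow> 'a) \<Rightarrow> bool" where
  "inclusion_solution G I \<phi> \<longleftrightarrow>
     is_interval I \<and> (\<forall>a b. a \<le> b \<and> {a..b} \<subseteq> I \<longrightarrow> inclusion_solution_compact G a b \<phi>)"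

text \<open>
  A solution on \<open>I\<close> is maximally extended forward in time if no solution that agrees with it on
  \<open>I\<close> is defined at a time beyond all of \<open>I\<close>. Values of \<open>\<phi>\<close> outside \<open>I\<close> carry no meaning.
\<close>

definition forward_maximal_solution ::
  "('a::real_normed_vector \<Rightarrow> 'a set) \<Rightarrow> real set \<Rightarrow> (real \<Rightarrow> 'a) \<Rightarrow> bool" where
  "forward_maximal_solution G I \<phi> \<longleftrightarrow>
     inclusion_solution G I \<phi> \<and>
     (\<forall>J \<psi>. I \<subseteq> J \<and> inclusion_solution G J \<psi> \<and> (\<forall>t\<in>I. \<psi> t = \<phi> t) \<longrightarrow>
        (\<forall>s\<in>J. \<exists>t\<in>I. s \<le> t))"

definition is_equilibrium :: "('a::real_normed_vector \<Rightarrow> 'a set) \<Rightarrow> 'a \<Rightarrow> bool" where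
  "is_equilibrium G p \<longleftrightarrow> inclusion_solution G UNIV (\<lambda>t. p)"

definition lyapunov_stable ::
  "('a::real_normed_vector \<Rightarrow> real) \<Rightarrow> ('a \<Rightarrow> 'a set) \<Rightarrow> 'a \<Rightarrow> bool" where
  "lyapunov_stable N G p \<longleftrightarrow> is_equilibrium G p \<and>
     (\<forall>\<epsilon>>0. \<exists>\<delta>>0. \<forall>I \<phi>.
        forward_maximal_solution G I \<phi> \<and> 0 \<in> I \<and> \<phi> 0 \<in> norm_ball N p \<delta> \<longrightarrow>
        {0..} \<subseteq> I \<and> (\<forall>t\<ge>0. \<phi> t \<in> norm_ball N p \<epsilon>))"

definition asymptotically_stable ::
  "('a::real_normed_vector \<Rightarrow> real) \<Rightarrow> ('a \<Rightarrow> 'a set) \<Rightarrow> 'a \<Rightarrow> bool" where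
  "asymptotically_stable N G p \<longleftrightarrow> lyapunov_stable N G p \<and>
     (\<exists>\<delta>>0. \<forall>I \<phi>.
        forward_maximal_solution G I \<phi> \<and> 0 \<in> I \<and> \<phi> 0 \<in> norm_ball N p \<delta> \<longrightarrow>
        {0..} \<subseteq> I \<and> (\<phi> \<longlongrightarrow> p) at_top)"

definition exponentially_stable ::
  "('a::real_normed_vector \<Rightarrow> real) \<Rightarrow> ('a \<Rightarrow> 'a set) \<Rightarrow> 'a \<Rightarrow> bool" where
  "exponentially_stable N G p \<longleftrightarrow> is_equilibrium G p \<and>
     (\<exists>\<alpha>\<ge>1. \<exists>\<beta>>0. \<exists>\<delta>>0. \<forall>I \<phi>.
        forward_maximal_solution G I \<phi> \<and> 0 \<in> I \<and> \<phi> 0 \<in> norm_ball N p \<delta> \<longrightarrow>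
        {0..} \<subseteq> I \<and> (\<forall>t\<ge>0. N (\<phi> t - p) \<le> \<alpha> * exp (- \<beta> * t) * N (\<phi> 0 - p)))"

lemma is_norm_bounded_above:
  fixes N :: "'a::euclidean_space \<Rightarrow> real"
  assumes "is_norm N"
  obtains K where "K > 0" "\<And>x. N x \<le> K * norm x"
proof
  let ?K = "1 + (\<Sum>b\<in>Basis. N b)"
  have nn: "\<And>x. 0 \<le> N x" and sc: "\<And>r x. N (r *\<^sub>R x) = \<bar>r\<bar> * N x"
    and tr: "\<And>x y. N (x + y) \<le> N x + N y" and z: "N 0 = 0"
    using assms by (auto simp: is_norm_def)
  show "?K > 0" using nn by (simp add: add_pos_nonneg sum_nonneg)
  fix x :: 'a
  have sum: "N (\<Sum>b\<in>S. f b) \<le> (\<Sum>b\<in>S. N (f b))" if "finite S" for S and f :: "'a \<Rightarrow> 'a"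
    using that
  proof (induction S)
    case empty
    then show ?case by (simp add: z)
  next
    case (insert b S)
    then show ?case using tr[of "f b" "sum f S"] by simp
  qed
  have "N x = N (\<Sum>b\<in>Basis. (x \<bullet> b) *\<^sub>R b)" by (simp add: euclidean_representation)
  also have "\<dots> \<le> (\<Sum>b\<in>Basis. N ((x \<bullet> b) *\<^sub>R b))" by (rule sum) simp
  also have "\<dots> \<le> (\<Sum>b\<in>Basis. norm x * N b)"
    by (intro sum_mono) (auto simp: sc intro!: mult_right_mono nn Basis_le_norm)
  also have "\<dots> \<le> ?K * norm x" by (simp add: sum_distrib_left algebra_simps)
  finally show "N x \<le> ?K * norm x" .
qed

lemma is_norm_continuous:
  fixes N :: "'a::euclidean_space \<Rightarrow> real"
  assumes "is_norm N"
  shows "continuous_on S N"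
proof -
  obtain K where K: "K > 0" "\<And>x. N x \<le> K * norm x" using is_norm_bounded_above[OF assms] by blast
  have "\<bar>N x - N y\<bar> \<le> K * dist x y" for x y
  proof -
    have "N x \<le> N (x - y) + N y" "N y \<le> N (y - x) + N x"
      using assms unfolding is_norm_def by (metis diff_add_cancel)+
    then show ?thesis using K(2)[of "x - y"] K(2)[of "y - x"]
      by (simp add: dist_norm norm_minus_commute abs_le_iff)
  qed
  then have "K-lipschitz_on S N"
    using K(1) by (intro lipschitz_onI) (auto simp: dist_real_def)
  then show ?thesis by (rule lipschitz_on_continuous_on)
qed

lemma is_norm_bounded_below:
  fixes N :: "'a::euclidean_space \<Rightarrow> real"
  assumes "is_norm N"
  obtains k where "k > 0" "\<And>x. k * norm x \<le> N x"
proof -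
  have ne: "sphere (0::'a) 1 \<noteq> {}" by simp
  obtain u where u: "u \<in> sphere 0 1" "\<And>y. y \<in> sphere 0 1 \<Longrightarrow> N u \<le> N y"
    using continuous_attains_inf[OF compact_sphere ne is_norm_continuous[OF assms]] by blast
  have "N u \<noteq> 0" using u(1) assms unfolding is_norm_def by auto
  then have pos: "N u > 0" using assms unfolding is_norm_def by (simp add: order_less_le)
  have "N u * norm x \<le> N x" for x
  proof (cases "x = 0")
    case True
    then show ?thesis using assms by (simp add: is_norm_def)
  next
    case False
    have "N u \<le> N ((1 / norm x) *\<^sub>R x)" using False by (intro u(2)) simp
    also have "\<dots> = N x / norm x" using assms by (simp add: is_norm_def)
    finally show ?thesis using False by (simp add: field_simps)
  qed
  then show ?thesis using pos that by blast
qed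

lemma filippov_map_subset:
  fixes N :: "real^'n \<Rightarrow> real"
  assumes N: "is_norm N" and S: "compact S" "convex S"
    and near: "\<And>\<epsilon>. \<epsilon> > 0 \<Longrightarrow> \<exists>\<delta>>0. \<forall>y. dist y x < \<delta> \<and> y $ i \<noteq> 0 \<longrightarrow> (\<exists>s\<in>S. dist (F y) s \<le> \<epsilon>)"
  shows "filippov_map N i F x \<subseteq> S"
proof
  fix z assume z: "z \<in> filippov_map N i F x"
  obtain k where k: "k > 0" "\<And>x. k * norm x \<le> N x" using is_norm_bounded_below[OF N] by blast
  have "\<exists>s\<in>S. dist s z < e" if "e > 0" for e
  proof -
    obtain \<delta> where \<delta>: "\<delta> > 0" "\<And>y. dist y x < \<delta> \<Longrightarrow> y $ i \<noteq> 0 \<Longrightarrow> \<exists>s\<in>S. dist (F y) s \<le> e / 2"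
      using near[of "e / 2"] \<open>e > 0\<close> by auto
    define T where "T = {s + v | s v. s \<in> S \<and> v \<in> cball 0 (e / 2)}"
    have T: "closed T" "convex T"
    proof -
      show "closed T"
        unfolding T_def using compact_sums[OF S(1) compact_cball] by (rule compact_imp_closed)
      have "T = (\<Union>s\<in>S. \<Union>v\<in>cball 0 (e / 2). {s + v})" unfolding T_def by blast
      then show "convex T" using convex_sums[OF S(2) convex_cball] by simp
    qed
    have "F ` (norm_ball N x (k * \<delta>) - {y. y $ i = 0}) \<subseteq> T"
    proof (rule image_subsetI)
      fix y assume "y \<in> norm_ball N x (k * \<delta>) - {y. y $ i = 0}"
      then have y: "y \<in> norm_ball N x (k * \<delta>)" "y $ i \<noteq> 0" by auto
      have "k * norm (x - y) < k * \<delta>" using k(2)[of "x - y"] y(1) by (simp add: norm_ball_def)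
      then have "dist y x < \<delta>" using k(1) by (simp add: dist_norm norm_minus_commute)
      then obtain s where "s \<in> S" "dist (F y) s \<le> e / 2" using \<delta>(2) y(2) by blast
      then have "F y = s + (F y - s) \<and> s \<in> S \<and> F y - s \<in> cball 0 (e / 2)"
        by (simp add: dist_norm norm_minus_commute)
      then show "F y \<in> T" unfolding T_def by blast
    qed
    then have "(\<lambda>S. closed S \<and> convex S) hull (F ` (norm_ball N x (k * \<delta>) - {y. y $ i = 0})) \<subseteq> T"
      using T by (intro hull_minimal) auto
    moreover have "k * \<delta> > 0" using k \<delta> by simp
    ultimately have "z \<in> T" using z unfolding filippov_map_def by blast
    then obtain s v where "s \<in> S" "norm v \<le> e / 2" "z = s + v" unfolding T_def by auto
    then show ?thesis using \<open>e > 0\<close> by (intro bexI[of _ s]) (auto simp: dist_norm)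
  qed
  then have "z \<in> closure S" by (auto simp: closure_approachable)
  then show "z \<in> S" using S by (simp add: compact_imp_closed)
qed

lemma filippov_map_limit:
  fixes N :: "real^'n \<Rightarrow> real"
  assumes N: "is_norm N"
    and near: "\<And>d. d > 0 \<Longrightarrow> \<exists>y. dist y x < d \<and> y $ i \<noteq> 0 \<and> dist (F y) v < d"
  shows "v \<in> filippov_map N i F x"
  unfolding filippov_map_def
proof
  fix \<delta> :: real assume "\<delta> \<in> {0<..}"
  then have \<delta>: "\<delta> > 0" by simp
  let ?B = "F ` (norm_ball N x \<delta> - {y. y $ i = 0})"
  obtain K where K: "K > 0" "\<And>x. N x \<le> K * norm x" using is_norm_bounded_above[OF N] by blast
  have "\<exists>w\<in>?B. dist w v < e" if "e > 0" for e
  proof -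
    have "min e (\<delta> / K) > 0" using that \<delta> K by simp
    then obtain y where y: "dist y x < min e (\<delta> / K)" "y $ i \<noteq> 0" "dist (F y) v < min e (\<delta> / K)"
      using near by blast
    have "N (x - y) \<le> K * norm (x - y)" by (rule K)
    also have "\<dots> < \<delta>"
      using y(1) K(1) by (simp add: dist_norm norm_minus_commute field_simps)
    finally have "F y \<in> ?B" using y by (auto simp: norm_ball_def)
    then show ?thesis using y by auto
  qed
  then have "v \<in> closure ?B" by (auto simp: closure_approachable)
  moreover have "closure ?B \<subseteq> (\<lambda>S. closed S \<and> convex S) hull ?B"
    by (intro closure_minimal hull_subset) (auto simp: hull_def)
  ultimately show "v \<in> (\<lambda>S. closed S \<and> convex S) hull ?B" by blast
qed

lemma convex_filippov_map: "convex (filippov_map N i F x)"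
  unfolding filippov_map_def by (auto simp: hull_def intro!: convex_Inter convex_INT)

lemma filippov_map_pws_field:
  fixes A :: "real^'n^'n"
  assumes N: "is_norm N"
  shows "filippov_map N i (pws_field i A c) x =
    (if x $ i < 0 then {A *v x}
     else if x $ i = 0 then {(1 - u) *\<^sub>R (A *v x) + u *\<^sub>R c | u. 0 \<le> u \<and> u \<le> 1}
     else {c})"
proof -
  let ?G = "filippov_map N i (pws_field i A c) x"
  have comp: "\<bar>y $ i - x $ i\<bar> \<le> dist y x" for y :: "real^'n"
    using component_le_norm_cart[of "y - x" i] by (simp add: dist_norm)
  have lin: "\<exists>\<delta>>0. \<forall>y. dist y x < \<delta> \<longrightarrow> dist (A *v y) (A *v x) < e" if "e > 0" for e
  proof -
    have "isCont ((*v) A) x" by (intro linear_continuous_at) simp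
    then show ?thesis using that by (auto simp: continuous_at_eps_delta)
  qed
  consider "x $ i < 0" | "x $ i = 0" | "x $ i > 0" by linarith
  then show ?thesis
  proof cases
    case 1
    have "?G \<subseteq> {A *v x}"
    proof (rule filippov_map_subset[OF N])
      fix e :: real assume "e > 0"
      then obtain d where d: "d > 0" "\<And>y. dist y x < d \<Longrightarrow> dist (A *v y) (A *v x) < e"
        using lin by blast
      show "\<exists>\<delta>>0. \<forall>y. dist y x < \<delta> \<and> y $ i \<noteq> 0 \<longrightarrow>
          (\<exists>s\<in>{A *v x}. dist (pws_field i A c y) s \<le> e)"
      proof (intro exI[of _ "min d (- x $ i)"] conjI allI impI)
        fix y assume y: "dist y x < min d (- x $ i) \<and> y $ i \<noteq> 0"
        then have "y $ i < 0" using comp[of y] by auto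
        then show "\<exists>s\<in>{A *v x}. dist (pws_field i A c y) s \<le> e"
          using d(2)[of y] y by (auto simp: pws_field_def)
      qed (use d 1 in auto)
    qed auto
    moreover have "A *v x \<in> ?G"
      using 1 by (intro filippov_map_limit[OF N] exI[of _ x]) (auto simp: pws_field_def)
    ultimately show ?thesis using 1 by auto
  next
    case 3
    have "?G \<subseteq> {c}"
    proof (rule filippov_map_subset[OF N])
      fix e :: real assume "e > 0"
      show "\<exists>\<delta>>0. \<forall>y. dist y x < \<delta> \<and> y $ i \<noteq> 0 \<longrightarrow>
          (\<exists>s\<in>{c}. dist (pws_field i A c y) s \<le> e)"
      proof (intro exI[of _ "x $ i"] conjI allI impI)
        fix y assume y: "dist y x < x $ i \<and> y $ i \<noteq> 0"
        then have "y $ i > 0" using comp[of y] by auto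
        then show "\<exists>s\<in>{c}. dist (pws_field i A c y) s \<le> e"
          using \<open>e > 0\<close> by (auto simp: pws_field_def)
      qed (use 3 in auto)
    qed auto
    moreover have "c \<in> ?G"
      using 3 by (intro filippov_map_limit[OF N] exI[of _ x]) (auto simp: pws_field_def)
    ultimately show ?thesis using 3 by auto
  next
    case 2
    have seg: "closed_segment (A *v x) c =
        {(1 - u) *\<^sub>R (A *v x) + u *\<^sub>R c | u. 0 \<le> u \<and> u \<le> 1}"
      by (simp add: closed_segment_def)
    have "?G \<subseteq> closed_segment (A *v x) c"
    proof (rule filippov_map_subset[OF N])
      fix e :: real assume "e > 0"
      then obtain d where d: "d > 0" "\<And>y. dist y x < d \<Longrightarrow> dist (A *v y) (A *v x) < e"
        using lin by blast
      show "\<exists>\<delta>>0. \<forall>y. dist y x < \<delta> \<and> y $ i \<noteq> 0 \<longrightarrow>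
          (\<exists>s\<in>closed_segment (A *v x) c. dist (pws_field i A c y) s \<le> e)"
      proof (intro exI[of _ d] conjI allI impI)
        fix y assume y: "dist y x < d \<and> y $ i \<noteq> 0"
        show "\<exists>s\<in>closed_segment (A *v x) c. dist (pws_field i A c y) s \<le> e"
        proof (cases "y $ i < 0")
          case True
          then show ?thesis using d(2)[of y] y
            by (intro bexI[of _ "A *v x"]) (auto simp: pws_field_def)
        next
          case False
          then show ?thesis using \<open>e > 0\<close>
            by (intro bexI[of _ c]) (auto simp: pws_field_def)
        qed
      qed (use d in auto)
    qed auto
    moreover have "A *v x \<in> ?G"
    proof (rule filippov_map_limit[OF N])
      fix d :: real assume "d > 0"
      then obtain r where r: "r > 0" "\<And>y. dist y x < r \<Longrightarrow> dist (A *v y) (A *v x) < d"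
        using lin by blast
      let ?y = "x - (min r d / 2) *\<^sub>R axis i 1"
      have "dist ?y x = min r d / 2" using r(1) \<open>d > 0\<close> by (simp add: dist_norm)
      then have "dist ?y x < d" "dist ?y x < r" using r(1) \<open>d > 0\<close> by auto
      moreover have "?y $ i < 0" using 2 r(1) \<open>d > 0\<close> by simp
      ultimately show "\<exists>y. dist y x < d \<and> y $ i \<noteq> 0 \<and> dist (pws_field i A c y) (A *v x) < d"
        using r(2)[of ?y] by (intro exI[of _ ?y]) (auto simp: pws_field_def)
    qed
    moreover have "c \<in> ?G"
    proof (rule filippov_map_limit[OF N])
      fix d :: real assume "d > 0"
      let ?y = "x + (d / 2) *\<^sub>R axis i 1"
      have "?y $ i > 0" using 2 \<open>d > 0\<close> by simp
      then show "\<exists>y. dist y x < d \<and> y $ i \<noteq> 0 \<and> dist (pws_field i A c y) c < d"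
        using \<open>d > 0\<close> by (intro exI[of _ ?y]) (auto simp: pws_field_def dist_norm)
    qed
    ultimately have "?G = closed_segment (A *v x) c"
      by (intro antisym closed_segment_subset convex_filippov_map)
    then show ?thesis using 2 seg by simp
  qed
qed

lemma is_equilibrium_origin:
  fixes A :: "real^'n^'n"
  assumes "is_norm N"
  shows "is_equilibrium (filippov_map N i (pws_field i A c)) 0"
proof -
  have "0 \<in> filippov_map N i (pws_field i A c) 0"
    by (auto simp: filippov_map_pws_field[OF assms] intro!: exI[of _ 0])
  then show ?thesis
    by (auto simp: is_equilibrium_def inclusion_solution_def inclusion_solution_compact_def
        abs_continuous_on_def is_interval_univ intro!: AE_I2 bexI[of _ 0] exI[of _ 1])
qed

end

theory Submission
  imports Defs
begin

text \<open>
  Only the step from asymptotic to exponential stability has content. For a linear system it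
  follows from homogeneity: a solution of size \<open>\<rho>\<close> is a scaled copy of one of size \<open>r\<close>, and
  compactness bounds the time in which every solution of size \<open>r\<close> shrinks by a given factor.
  The present system is not homogeneous, since \<open>c\<close> does not scale, but its orbits are: if
  \<open>x' = (1 - \<lambda>) A x + \<lambda> c\<close> and \<open>y = \<kappa> x\<close>, then
  \<open>y' = (1 - \<lambda>) A y + \<lambda> \<kappa> c\<close>, which is
  \<open>1 + (\<kappa> - 1) \<lambda>\<close> times a convex combination of \<open>A y\<close> and \<open>c\<close>. In the new time
  \<open>\<theta>(t) = t + (\<kappa> - 1) \<Lambda>(t)\<close>, where \<open>\<Lambda>\<close> is the integral of \<open>\<lambda>\<close>, the curve \<open>\<kappa> x\<close> is therefore again
  a Filippov solution. For \<open>\<kappa> \<ge> 1\<close> the new time runs ahead of the old one, so a statement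
  about \<open>\<kappa> x\<close> at all late new times covers all late old times. Thus the contraction of solutions of size at most \<open>r\<close> to
  size \<open>r / 2\<close> after time \<open>T\<close> yields \<open>N (x t) \<le> N (x 0) / 2\<close> for all \<open>t \<ge> T\<close> and all small initial
  values, and iteration gives an exponential rate.

  To avoid changing variables in differential inclusions and taking limits of derivatives,
  the pair of \<open>x\<close> and the clock \<open>\<Lambda>\<close> is described by inequalities between values at two times
  (\<open>clocked_solution\<close>). These survive rescaling (\<open>clocked_solution_scale\<close>) and pointwise limits,
  so that Tychonoff's theorem gives compactness (\<open>clocked_solutions_limit\<close>). Derivatives enter only
  in the two translations. From Filippov solutions to clocked ones, \<open>\<lambda>\<close> is read off from the
  derivative and integrated, which needs the fundamental theorem of calculus for absolutely
  continuous functions. In the other direction, the monotone Lipschitz function \<open>\<Lambda>\<close> is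
  differentiable almost everywhere, and where it is, so is \<open>x\<close>.
\<close>

section \<open>Fundamental theorem of calculus for absolutely continuous functions\<close>

text \<open>
  In a fine tagged division, the intervals tagged outside the exceptional set are handled by
  the derivative, as in the fundamental theorem for everywhere differentiable functions. Those tagged
  inside it lie in an open set of small measure, so absolute continuity makes the variation over
  them small.
\<close>

lemma abs_continuous_has_integral:
  fixes f :: "real \<Rightarrow> 'a::banach"
  assumes "a \<le> b" and ac: "abs_continuous_on a b f" and Z: "negligible Z"
    and deriv: "\<And>x. x \<in> {a..b} - Z \<Longrightarrow> (f has_vector_derivative f' x) (at x within {a..b})"
  shows "(f' has_integral (f b - f a)) {a..b}"
proof -
  define g where "g = (\<lambda>x. if x \<in> Z then 0 else f' x)"
  have "(g has_integral (f b - f a)) {a..b}"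
    unfolding has_integral_real
  proof (intro allI impI)
    fix e :: real assume "e > 0"
    define e1 where "e1 = e / 2 / (b - a + 1)"
    have e1: "e1 > 0" "e1 * (b - a) < e / 2"
      using \<open>e > 0\<close> \<open>a \<le> b\<close> by (auto simp: e1_def field_simps)
    have "e / 2 > 0" using \<open>e > 0\<close> by simp
    then obtain \<delta> where \<delta>: "\<delta> > 0"
      and var: "\<forall>D T. D division_of T \<and> T \<subseteq> {a..b} \<and> (\<Sum>k\<in>D. Sup k - Inf k) < \<delta> \<longrightarrow>
        (\<Sum>k\<in>D. norm (f (Sup k) - f (Inf k))) < e / 2"
      using ac unfolding abs_continuous_on_def by blast
    have "Z \<in> sets lebesgue" using Z by (simp add: negligible_imp_sets)
    then obtain U where U: "open U" "Z \<subseteq> U" "U - Z \<in> lmeasurable" "emeasure lebesgue (U - Z) < ennreal \<delta>"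
      using sets_lebesgue_outer_open \<open>\<delta> > 0\<close> by blast
    have "\<forall>x. \<exists>d>0. (x \<in> {a..b} - Z \<longrightarrow>
         (\<forall>y\<in>{a..b}. norm (y-x) < d \<longrightarrow> norm (f y - f x - (y-x) *\<^sub>R f' x) \<le> e1 * norm (y-x)))
       \<and> (x \<in> Z \<longrightarrow> ball x d \<subseteq> U)"
    proof
      fix x
      show "\<exists>d>0. (x \<in> {a..b} - Z \<longrightarrow>
         (\<forall>y\<in>{a..b}. norm (y-x) < d \<longrightarrow> norm (f y - f x - (y-x) *\<^sub>R f' x) \<le> e1 * norm (y-x)))
       \<and> (x \<in> Z \<longrightarrow> ball x d \<subseteq> U)"
      proof (cases "x \<in> Z")
        case True
        then show ?thesis using U(1,2) open_contains_ball_eq by blast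
      next
        case False
        show ?thesis
        proof (cases "x \<in> {a..b}")
          case True
          then show ?thesis using deriv[of x] False e1(1)
            unfolding has_vector_derivative_def has_derivative_within_alt by blast
        qed (use False in \<open>auto intro: exI[of _ 1]\<close>)
      qed
    qed
    then obtain d where d: "\<And>x. 0 < d x"
      and d_good: "\<And>x y. \<lbrakk>x \<in> {a..b}; x \<notin> Z; y \<in> {a..b}; norm (y-x) < d x\<rbrakk>
           \<Longrightarrow> norm (f y - f x - (y-x) *\<^sub>R f' x) \<le> e1 * norm (y-x)"
      and d_Z: "\<And>x. x \<in> Z \<Longrightarrow> ball x (d x) \<subseteq> U"
      by (metis DiffI)
    have main: "norm ((\<Sum>(x, k)\<in>p. measure lborel k *\<^sub>R g x) - (f b - f a)) < e"
      if p: "p tagged_division_of {a..b}" and fine: "(\<lambda>x. ball x (d x)) fine p" for p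
    proof -
      have ba: "b - a = (\<Sum>(x,K)\<in>p. Sup K - Inf K)" "f b - f a = (\<Sum>(x,K)\<in>p. f(Sup K) - f(Inf K))"
        using additive_tagged_division_1[OF \<open>a \<le> b\<close> p, of "\<lambda>x. x"]
          additive_tagged_division_1[OF \<open>a \<le> b\<close> p, of f] by auto
      have fin: "finite p" using p by blast
      define B where "B = p \<inter> {t. fst t \<in> Z}"
      have ivl: "\<exists>u v. K = {u..v} \<and> u \<le> v \<and> x \<in> {u..v} \<and> {u..v} \<subseteq> {a..b} \<and> {u..v} \<subseteq> ball x (d x)"
        if "(x, K) \<in> p" for x K
        using tagged_division_ofD(2,3,4)[OF p that] fineD[OF fine that] by fastforce
      have nonneg: "0 \<le> Sup K - Inf K" if "(x, K) \<in> p" for x K using ivl[OF that] by force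
      have good: "norm (measure lborel K *\<^sub>R g x - (f (Sup K) - f (Inf K))) \<le> e1 * (Sup K - Inf K)"
        if xK: "(x, K) \<in> p - B" for x K
      proof -
        have xK': "(x, K) \<in> p" and "x \<notin> Z" using xK by (auto simp: B_def)
        obtain u v where k: "K = {u..v}" "u \<le> v" "x \<in> {u..v}" "{u..v} \<subseteq> {a..b}" "{u..v} \<subseteq> ball x (d x)"
          using ivl[OF xK'] by blast
        have uv: "u \<in> ball x (d x)" "v \<in> ball x (d x)" "u \<in> {a..b}" "v \<in> {a..b}" "x \<in> {a..b}"
          using k(2-4) subsetD[OF k(5), of u] subsetD[OF k(5), of v] by auto
        have "norm ((v - u) *\<^sub>R f' x - (f v - f u)) = norm (f u - f x - (u - x) *\<^sub>R f' x - (f v - f x - (v - x) *\<^sub>R f' x))"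
          by (auto simp: algebra_simps)
        also have "\<dots> \<le> norm (f u - f x - (u - x) *\<^sub>R f' x) + norm (f v - f x - (v - x) *\<^sub>R f' x)"
          by (rule norm_triangle_ineq4)
        also have "\<dots> \<le> e1 * norm (u - x) + e1 * norm (v - x)"
          using uv \<open>x \<notin> Z\<close> by (intro add_mono d_good) (auto simp: dist_real_def)
        also have "\<dots> = e1 * (v - u)" using k by (auto simp: algebra_simps)
        finally show ?thesis using k \<open>x \<notin> Z\<close> by (simp add: g_def)
      qed
      have part: "B tagged_partial_division_of {a..b}"
        using p by (auto simp: B_def tagged_division_of_def intro: tagged_partial_division_subset)
      have div: "snd ` B division_of \<Union>(snd ` B)"
        by (rule partial_division_of_tagged_division[OF part])
      have Bdiv: "B tagged_division_of \<Union>(snd ` B)"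
        by (rule tagged_partial_division_of_Union_self[OF part])
      have len: "(\<Sum>K\<in>snd ` B. Sup K - Inf K) < \<delta>"
      proof -
        have "(\<Sum>K\<in>snd ` B. Sup K - Inf K) = (\<Sum>K\<in>snd ` B. measure lebesgue K)"
        proof (rule sum.cong[OF refl])
          fix K assume "K \<in> snd ` B"
          then obtain x where "(x, K) \<in> p" by (auto simp: B_def)
          then show "Sup K - Inf K = measure lebesgue K" using ivl[of x K] by auto
        qed
        also have "\<dots> = measure lebesgue (\<Union>(snd ` B))" by (rule content_division[OF div])
        also have "\<dots> = measure lebesgue (\<Union>(snd ` B) - Z)"
          using Z by (intro measure_Diff_null_set[symmetric])
            (auto simp: negligible_iff_null_sets intro!: lmeasurable_division[OF div] fmeasurableD)
        also have "\<dots> \<le> measure lebesgue (U - Z)"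
        proof (rule measure_mono_fmeasurable)
          have "K \<subseteq> U" if "(x, K) \<in> B" for x K
            using that ivl[of x K] d_Z[of x] by (auto simp: B_def)
          then show "\<Union>(snd ` B) - Z \<subseteq> U - Z" by fastforce
          show "\<Union>(snd ` B) - Z \<in> sets lebesgue"
            using lmeasurable_division[OF div] Z by (auto intro: fmeasurableD negligible_imp_sets)
        qed (rule U)
        also have "\<dots> < \<delta>"
          using U(3,4) \<open>\<delta> > 0\<close> by (simp add: emeasure_eq_measure2 ennreal_less_iff)
        finally show ?thesis .
      qed
      define h where "h = (\<lambda>K. if K = {} then 0 else norm (f (Sup K) - f (Inf K)))"
      have "(\<Sum>(x,K)\<in>B. norm (f (Sup K) - f (Inf K))) = (\<Sum>(x,K)\<in>B. h K)"
        using ivl by (intro sum.cong) (fastforce simp: h_def B_def)+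
      also have "\<dots> = (\<Sum>K\<in>snd ` B. h K)"
      proof (rule sum.over_tagged_division_lemma[OF Bdiv])
        fix u v :: real assume "box u v = {}"
        then have "v < u \<or> u = v" by auto
        then show "h (cbox u v) = 0" by (auto simp: h_def)
      qed
      also have "\<dots> = (\<Sum>K\<in>snd ` B. norm (f (Sup K) - f (Inf K)))"
        using ivl by (intro sum.cong) (fastforce simp: h_def B_def)+
      also have "\<dots> < e / 2"
      proof -
        have "\<Union>(snd ` B) \<subseteq> {a..b}" using ivl by (fastforce simp: B_def)
        then show ?thesis using var div len by blast
      qed
      finally have bad: "(\<Sum>(x,K)\<in>B. norm (f (Sup K) - f (Inf K))) < e / 2" .
      have "norm ((\<Sum>(x, k)\<in>p. measure lborel k *\<^sub>R g x) - (f b - f a))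
          = norm (\<Sum>(x,K)\<in>p. measure lborel K *\<^sub>R g x - (f (Sup K) - f (Inf K)))"
        by (simp add: ba(2) sum_subtractf split_def)
      also have "\<dots> \<le> (\<Sum>(x,K)\<in>p. norm (measure lborel K *\<^sub>R g x - (f (Sup K) - f (Inf K))))"
        by (rule order_trans[OF norm_sum]) (simp add: split_def)
      also have "\<dots> = (\<Sum>(x,K)\<in>p - B. norm (measure lborel K *\<^sub>R g x - (f (Sup K) - f (Inf K))))
          + (\<Sum>(x,K)\<in>B. norm (measure lborel K *\<^sub>R g x - (f (Sup K) - f (Inf K))))"
        by (rule sum.subset_diff) (auto simp: B_def fin)
      also have "(\<Sum>(x,K)\<in>B. norm (measure lborel K *\<^sub>R g x - (f (Sup K) - f (Inf K))))
          = (\<Sum>(x,K)\<in>B. norm (f (Sup K) - f (Inf K)))"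
        by (rule sum.cong) (auto simp: B_def g_def norm_minus_commute)
      also have "(\<Sum>(x,K)\<in>p - B. norm (measure lborel K *\<^sub>R g x - (f (Sup K) - f (Inf K))))
          \<le> (\<Sum>(x,K)\<in>p - B. e1 * (Sup K - Inf K))"
        using good by (intro sum_mono) auto
      also have "\<dots> \<le> (\<Sum>(x,K)\<in>p. e1 * (Sup K - Inf K))"
        using nonneg e1(1) by (intro sum_mono2 fin) (auto simp: split_def)
      also have "\<dots> = e1 * (b - a)"
        by (simp add: ba(1) sum_distrib_left split_def)
      finally show ?thesis using bad e1(2) by linarith
    qed
    show "\<exists>\<gamma>. gauge \<gamma> \<and> (\<forall>p. p tagged_division_of {a..b} \<and> \<gamma> fine p \<longrightarrow>
        norm ((\<Sum>(x, k)\<in>p. measure lborel k *\<^sub>R g x) - (f b - f a)) < e)"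
      using main d gauge_ball_dependent by blast
  qed
  then show ?thesis
    by (rule has_integral_spike[OF Z, rotated]) (auto simp: g_def)
qed

section \<open>Almost everywhere differentiability of monotone Lipschitz functions\<close>

text \<open>
  Both \<open>\<Lambda>\<close> and \<open>t - \<Lambda> t\<close> are monotone and continuous, and their Stieltjes measures add up to
  Lebesgue measure. Hence the measure of \<open>\<Lambda>\<close> is absolutely continuous and has a density by the
  Radon--Nikodym theorem.
\<close>

lemma lipschitz_monotone_density:
  fixes \<Lambda> :: "real \<Rightarrow> real"
  assumes mono: "\<And>s t. s \<le> t \<Longrightarrow> \<Lambda> s \<le> \<Lambda> t" and lip: "\<And>s t. s \<le> t \<Longrightarrow> \<Lambda> t - \<Lambda> s \<le> t - s"
  obtains g :: "real \<Rightarrow> real" where "\<And>a b. a \<le> b \<Longrightarrow> (g has_integral (\<Lambda> b - \<Lambda> a)) {a..b}"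
proof -
  define D where "D = (\<lambda>t. t - \<Lambda> t)"
  have "1-lipschitz_on UNIV \<Lambda>"
  proof (rule lipschitz_onI)
    fix x y show "dist (\<Lambda> x) (\<Lambda> y) \<le> 1 * dist x y"
      using mono[of x y] lip[of x y] mono[of y x] lip[of y x] by (auto simp: dist_real_def abs_if)
  qed auto
  then have cont: "continuous_on UNIV \<Lambda>" by (rule lipschitz_on_continuous_on)
  then have contD: "continuous_on UNIV D" unfolding D_def by (intro continuous_intros)
  have rc: "continuous (at_right a) \<Lambda>" "continuous (at_right a) D" for a
    using cont contD by (auto simp: continuous_on_eq_continuous_within intro: continuous_at_imp_continuous_at_within)
  have monoD: "s \<le> t \<Longrightarrow> D s \<le> D t" for s t using lip[of s t] by (simp add: D_def)
  let ?M = "interval_measure \<Lambda>" and ?D = "interval_measure D"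
  \<comment> \<open>the sum of the two Stieltjes measures, which turns out to be Lebesgue measure\<close>
  define S where "S = measure_of UNIV (sets borel) (\<lambda>A. emeasure ?M A + emeasure ?D A)"
  have em: "emeasure S A = emeasure ?M A + emeasure ?D A" if "A \<in> sets borel" for A
    unfolding S_def
  proof (rule emeasure_measure_of_sigma)
    show "sigma_algebra UNIV (sets (borel::real measure))"
      using sets.sigma_algebra_axioms[of "borel::real measure"] by simp
    show "positive (sets borel) (\<lambda>A. emeasure ?M A + emeasure ?D A)" by (simp add: positive_def)
    show "countably_additive (sets borel) (\<lambda>A. emeasure ?M A + emeasure ?D A)"
    proof (rule countably_additiveI)
      fix F :: "nat \<Rightarrow> real set"
      assume F: "range F \<subseteq> sets borel" "disjoint_family F" "\<Union> (range F) \<in> sets borel"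
      have "(\<Sum>i. emeasure ?M (F i) + emeasure ?D (F i)) = (\<Sum>i. emeasure ?M (F i)) + (\<Sum>i. emeasure ?D (F i))"
        by (intro suminf_add[symmetric]) auto
      also have "\<dots> = emeasure ?M (\<Union> (range F)) + emeasure ?D (\<Union> (range F))"
        using F by (simp add: suminf_emeasure)
      finally show "(\<Sum>i. emeasure ?M (F i) + emeasure ?D (F i))
        = emeasure ?M (\<Union> (range F)) + emeasure ?D (\<Union> (range F))" .
    qed
    show "A \<in> sets borel" by fact
  qed
  have "lborel = S"
  proof (rule lborel_eqI)
    show setsS: "sets S = sets borel" unfolding S_def
      by (metis sets.sets_measure_of_eq space_borel)
    fix l u :: real
    assume "\<And>b. b \<in> Basis \<Longrightarrow> l \<bullet> b \<le> u \<bullet> b"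
    then have "l \<le> u" by simp
    have pt: "emeasure (interval_measure \<Lambda>) {u} = 0" "emeasure (interval_measure D) {u} = 0"
      using emeasure_interval_measure_Icc[OF order_refl mono cont, of u]
        emeasure_interval_measure_Icc[OF order_refl monoD contD, of u] by auto
    have "emeasure S {l<..u} = ennreal (\<Lambda> u - \<Lambda> l) + ennreal (D u - D l)"
      using \<open>l \<le> u\<close> mono monoD rc by (simp add: em emeasure_interval_measure_Ioc)
    also have "\<dots> = ennreal (u - l)"
      using mono[OF \<open>l \<le> u\<close>] monoD[OF \<open>l \<le> u\<close>] by (simp flip: ennreal_plus add: D_def)
    finally have "emeasure S {l<..u} = ennreal (u - l)" .
    moreover have "emeasure S ({l<..<u} \<union> ({u} \<inter> {l<..u})) = emeasure S {l<..<u}"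
    proof (rule emeasure_Un_null_set)
      have "{u} \<in> null_sets S" using pt by (auto simp: setsS em null_sets_def)
      then show "{u} \<inter> {l<..u} \<in> null_sets S" by (rule null_sets_subset) (auto simp: setsS)
    qed (simp add: setsS)
    moreover have "{l<..<u} \<union> ({u} \<inter> {l<..u}) = {l<..u}" by auto
    ultimately show "emeasure S (box l u) = ennreal (\<Prod>b\<in>Basis. (u - l) \<bullet> b)" by simp
  qed
  have ac: "absolutely_continuous lborel ?M"
    unfolding absolutely_continuous_def
  proof
    fix A assume A: "A \<in> null_sets (lborel::real measure)"
    then have "A \<in> sets borel" "emeasure S A = 0" using \<open>lborel = S\<close> by auto
    then show "A \<in> null_sets ?M" using em[of A] by auto
  qed
  obtain f where f: "f \<in> borel_measurable lborel" "density lborel f = ?M"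
    using sigma_finite_measure.Radon_Nikodym[OF sigma_finite_lborel ac] by auto
  have int_f: "(\<integral>\<^sup>+x. f x * indicator {a..b} x \<partial>lborel) = ennreal (\<Lambda> b - \<Lambda> a)" if "a \<le> b" for a b
  proof -
    have "emeasure (density lborel f) {a..b} = (\<integral>\<^sup>+x. f x * indicator {a..b} x \<partial>lborel)"
      by (rule emeasure_density) (use f in auto)
    then show ?thesis using f emeasure_interval_measure_Icc[OF that mono cont] by simp
  qed
  have fin: "AE x in lborel. f x \<noteq> \<infinity>"
  proof -
    have "AE x in lborel. \<forall>n::nat. f x * indicator {- real n..real n} x \<noteq> \<infinity>"
    proof (subst AE_all_countable, rule allI)
      fix n :: nat
      show "AE x in lborel. f x * indicator {- real n..real n} x \<noteq> \<infinity>"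
        using f int_f[of "- real n" "real n"] by (intro nn_integral_PInf_AE) auto
    qed
    then show ?thesis
    proof eventually_elim
      fix x assume *: "\<forall>n::nat. f x * indicator {- real n..real n} x \<noteq> \<infinity>"
      obtain n where "\<bar>x\<bar> \<le> real n" using real_arch_simple by blast
      then show "f x \<noteq> \<infinity>" using *[rule_format, of n] by (auto simp: indicator_def abs_le_iff)
    qed
  qed
  define g where "g = (\<lambda>x. enn2real (f x))"
  have g_meas: "g \<in> borel_measurable borel" using f by (simp add: g_def)
  have "(g has_integral (\<Lambda> b - \<Lambda> a)) {a..b}" if "a \<le> b" for a b
  proof -
    have "((\<lambda>x. g x * indicator {a..b} x) has_integral (\<Lambda> b - \<Lambda> a)) UNIV"
    proof (rule nn_integral_has_integral)
      show "(\<integral>\<^sup>+x. ennreal (g x * indicator {a..b} x) \<partial>lborel) = ennreal (\<Lambda> b - \<Lambda> a)"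
        unfolding int_f[OF that, symmetric]
        by (rule nn_integral_cong_AE, use fin in eventually_elim)
          (auto simp: g_def indicator_def less_top)
    qed (use g_meas mono[OF that] in \<open>auto simp: g_def\<close>)
    moreover have "(\<lambda>x. g x * indicator {a..b} x) = (\<lambda>x. if x \<in> {a..b} then g x else 0)" by auto
    ultimately show ?thesis by (simp only: has_integral_restrict_UNIV)
  qed
  then show ?thesis by (rule that)
qed

text \<open>
  Lebesgue's differentiation theorem on the cubes \<open>[t, t + h]\<close>, which gives the right-hand
  derivative only.
\<close>

lemma right_derivative_AE:
  fixes \<Lambda> :: "real \<Rightarrow> real"
  assumes int: "\<And>a b. a \<le> b \<Longrightarrow> (g has_integral (\<Lambda> b - \<Lambda> a)) {a..b}"
  obtains Z where "negligible Z" "\<And>t. t \<notin> Z \<Longrightarrow> (\<Lambda> has_real_derivative g t) (at_right t)"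
proof -
  have "g integrable_on cbox a b" for a b
    using int[of a b] by (cases "a \<le> b") (auto simp: has_integral_integrable)
  then obtain Z where Z: "negligible Z"
    and lim: "\<And>x e. \<lbrakk>x \<notin> Z; 0 < e\<rbrakk> \<Longrightarrow>
      \<exists>d>0. \<forall>h. 0 < h \<and> h < d \<longrightarrow> norm (integral (cbox x (x + h *\<^sub>R One)) g /\<^sub>R h ^ DIM(real) - g x) < e"
    using integrable_ccontinuous_explicit by blast
  have "(\<Lambda> has_real_derivative g t) (at_right t)" if "t \<notin> Z" for t
    unfolding has_field_derivative_iff tendsto_iff eventually_at_right_field
  proof (intro allI impI)
    fix e :: real assume "e > 0"
    then obtain d where d: "d > 0"
      "\<And>h. 0 < h \<Longrightarrow> h < d \<Longrightarrow> norm (integral (cbox t (t + h *\<^sub>R One)) g /\<^sub>R h ^ DIM(real) - g t) < e"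
      using lim \<open>t \<notin> Z\<close> by meson
    have "dist ((\<Lambda> y - \<Lambda> t) / (y - t)) (g t) < e" if y: "t < y" "y < t + d" for y
    proof -
      have "integral {t..y} g = \<Lambda> y - \<Lambda> t" using int[of t y] y by (simp add: integral_unique)
      then show ?thesis using d(2)[of "y - t"] y by (simp add: dist_real_def divide_inverse_commute)
    qed
    then show "\<exists>b>t. \<forall>y>t. y < b \<longrightarrow> dist ((\<Lambda> y - \<Lambda> t) / (y - t)) (g t) < e"
      using \<open>d > 0\<close> by (intro exI[of _ "t + d"]) auto
  qed
  then show ?thesis using Z that by blast
qed

text \<open>
  The left-hand derivative of \<open>\<Lambda>\<close> is the right-hand derivative of the reflected function
  \<open>- \<Lambda> (- t)\<close>, whose density is the reflected density.
\<close>

lemma lipschitz_monotone_differentiable_AE: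
  fixes \<Lambda> :: "real \<Rightarrow> real"
  assumes mono: "\<And>s t. s \<le> t \<Longrightarrow> \<Lambda> s \<le> \<Lambda> t" and lip: "\<And>s t. s \<le> t \<Longrightarrow> \<Lambda> t - \<Lambda> s \<le> t - s"
  obtains Z g where "negligible Z" "\<And>t. t \<notin> Z \<Longrightarrow> (\<Lambda> has_real_derivative g t) (at t)"
proof -
  obtain g where g: "\<And>a b. a \<le> b \<Longrightarrow> (g has_integral (\<Lambda> b - \<Lambda> a)) {a..b}"
    using lipschitz_monotone_density[of \<Lambda>] assms by blast
  obtain Z where Z: "negligible Z" "\<And>t. t \<notin> Z \<Longrightarrow> (\<Lambda> has_real_derivative g t) (at_right t)"
    using right_derivative_AE[OF g] by blast
  have "((\<lambda>t. g (- t)) has_integral - \<Lambda> (- b) - (- \<Lambda> (- a))) {a..b}" if "a \<le> b" for a b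
    using g[of "-b" "-a"] that has_integral_reflect_real[where f = g and a = "-b" and b = "-a"] by simp
  then obtain Z' where Z': "negligible Z'"
    "\<And>t. t \<notin> Z' \<Longrightarrow> ((\<lambda>t. - \<Lambda> (- t)) has_real_derivative g (- t)) (at_right t)"
    using right_derivative_AE[of "\<lambda>t. g (- t)" "\<lambda>t. - \<Lambda> (- t)"] by blast
  have "negligible (Z \<union> uminus ` Z')"
    using Z(1) Z'(1) by (intro negligible_Un negligible_differentiable_image_negligible)
      (auto intro!: differentiable_on_minus differentiable_on_ident)
  moreover have "(\<Lambda> has_real_derivative g t) (at t)" if "t \<notin> Z \<union> uminus ` Z'" for t
  proof -
    have "- t \<notin> Z'" using that by (metis UnI2 image_eqI minus_minus)
    have "((\<lambda>t. - \<Lambda> (- t)) has_real_derivative g t) (at_right (- t))"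
      using Z'(2)[OF \<open>- t \<notin> Z'\<close>] by simp
    moreover have "(- \<Lambda> (- x) - (- \<Lambda> (- (- t)))) / (x - (- t)) = (\<Lambda> (- x) - \<Lambda> t) / (- x - t)" for x
      using minus_divide_divide[of "\<Lambda> (- x) - \<Lambda> t" "- x - t"] by (simp add: add.commute)
    ultimately have "((\<lambda>x. (\<Lambda> (- x) - \<Lambda> t) / (- x - t)) \<longlongrightarrow> g t) (at_right (- t))"
      unfolding has_field_derivative_iff by simp
    then have "(\<Lambda> has_real_derivative g t) (at_left t)"
      unfolding has_field_derivative_iff unfolding at_left_minus[of t] filterlim_filtermap .
    moreover have "(\<Lambda> has_real_derivative g t) (at_right t)" using Z(2) that by blast
    ultimately show ?thesis
      by (simp add: has_field_derivative_iff filterlim_at_split)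
  qed
  ultimately show ?thesis by (rule that)
qed

section \<open>Solutions with a clock\<close>

text \<open>
  The clock \<open>\<Lambda> t\<close> is the share of the time up to \<open>t\<close> that a solution spends following \<open>c\<close>, that
  is, the integral of the weight \<open>\<lambda>\<close> in \<open>\<phi>' = (1 - \<lambda>) A \<phi> + \<lambda> c\<close>. The norm estimate is the first
  order Taylor expansion in the two elapsed times, and its quadratic error allows the differential
  equation to be recovered. If \<open>L\<close> bounds the speed, then \<open>\<phi>\<close> cannot reach the switching manifold
  within time \<open>t - s\<close> as long as its distance from it exceeds \<open>L (t - s)\<close>; the last two conditions
  prescribe the weight during such a stay on one side. All conditions compare values at two
  times by non-strict inequalities, or by equations subject to a strict inequality, so they are
  closed under pointwise convergence.
\<close>

definition clocked_solution ::
  "'n \<Rightarrow> real^'n^'n \<Rightarrow> real^'n \<Rightarrow> real \<Rightarrow> real \<Rightarrow> (real \<Rightarrow> real^'n) \<Rightarrow> (real \<Rightarrow> real) \<Rightarrow> bool" where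
  "clocked_solution i A c C L \<phi> \<Lambda> \<longleftrightarrow> \<Lambda> 0 = 0 \<and> (\<forall>s t. 0 \<le> s \<and> s \<le> t \<longrightarrow>
     0 \<le> \<Lambda> t - \<Lambda> s \<and> \<Lambda> t - \<Lambda> s \<le> t - s \<and>
     norm (\<phi> t - \<phi> s - ((t - s) - (\<Lambda> t - \<Lambda> s)) *\<^sub>R (A *v \<phi> s) - (\<Lambda> t - \<Lambda> s) *\<^sub>R c)
       \<le> C * (t - s)\<^sup>2 \<and>
     (L * (t - s) < \<phi> s $ i \<longrightarrow> \<Lambda> t - \<Lambda> s = t - s) \<and>
     (\<phi> s $ i < - (L * (t - s)) \<longrightarrow> \<Lambda> t - \<Lambda> s = 0))"

lemma clocked_solutionD:
  assumes "clocked_solution i A c C L \<phi> \<Lambda>"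
  shows "\<Lambda> 0 = 0"
    and "0 \<le> s \<Longrightarrow> s \<le> t \<Longrightarrow> 0 \<le> \<Lambda> t - \<Lambda> s"
    and "0 \<le> s \<Longrightarrow> s \<le> t \<Longrightarrow> \<Lambda> t - \<Lambda> s \<le> t - s"
    and "0 \<le> s \<Longrightarrow> s \<le> t \<Longrightarrow>
      norm (\<phi> t - \<phi> s - ((t - s) - (\<Lambda> t - \<Lambda> s)) *\<^sub>R (A *v \<phi> s) - (\<Lambda> t - \<Lambda> s) *\<^sub>R c)
        \<le> C * (t - s)\<^sup>2"
    and "0 \<le> s \<Longrightarrow> s \<le> t \<Longrightarrow> L * (t - s) < \<phi> s $ i \<Longrightarrow> \<Lambda> t - \<Lambda> s = t - s"
    and "0 \<le> s \<Longrightarrow> s \<le> t \<Longrightarrow> \<phi> s $ i < - (L * (t - s)) \<Longrightarrow> \<Lambda> t - \<Lambda> s = 0"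
  using assms unfolding clocked_solution_def by blast+

lemma clocked_solution_error_nonneg:
  assumes "clocked_solution i A c C L \<phi> \<Lambda>"
  shows "0 \<le> C"
  using order_trans[OF norm_ge_zero clocked_solutionD(4)[OF assms, of 0 1]] by simp

lemma clocked_solution_shift:
  assumes "clocked_solution i A c C L \<phi> \<Lambda>" and "0 \<le> a"
  shows "clocked_solution i A c C L (\<lambda>t. \<phi> (t + a)) (\<lambda>t. \<Lambda> (t + a) - \<Lambda> a)"
  unfolding clocked_solution_def
proof (intro conjI[of "\<Lambda> (0 + a) - \<Lambda> a = 0"] allI impI)
  fix s t :: real assume "0 \<le> s \<and> s \<le> t"
  then have "0 \<le> s + a" "s + a \<le> t + a" "t - s = (t + a) - (s + a)" using assms(2) by auto
  note * = clocked_solutionD(2-)[OF assms(1) this(1,2), folded this(3)]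
  show "0 \<le> \<Lambda> (t + a) - \<Lambda> a - (\<Lambda> (s + a) - \<Lambda> a) \<and>
    \<Lambda> (t + a) - \<Lambda> a - (\<Lambda> (s + a) - \<Lambda> a) \<le> t - s \<and>
    norm (\<phi> (t + a) - \<phi> (s + a)
        - (t - s - (\<Lambda> (t + a) - \<Lambda> a - (\<Lambda> (s + a) - \<Lambda> a))) *\<^sub>R (A *v \<phi> (s + a))
        - (\<Lambda> (t + a) - \<Lambda> a - (\<Lambda> (s + a) - \<Lambda> a)) *\<^sub>R c) \<le> C * (t - s)\<^sup>2 \<and>
    (L * (t - s) < \<phi> (s + a) $ i \<longrightarrow> \<Lambda> (t + a) - \<Lambda> a - (\<Lambda> (s + a) - \<Lambda> a) = t - s) \<and>
    (\<phi> (s + a) $ i < - (L * (t - s)) \<longrightarrow> \<Lambda> (t + a) - \<Lambda> a - (\<Lambda> (s + a) - \<Lambda> a) = 0)"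
    using * by simp
qed simp

text \<open>
  The new time advances at rate \<open>1 + (\<kappa> - 1) \<lambda>\<close>, the speed of \<open>\<kappa> \<phi>\<close> relative to the system. The time
  spent following \<open>A\<close> is unchanged and the time spent following \<open>c\<close> is multiplied by \<open>\<kappa>\<close>, so the clock
  of the scaled solution is \<open>\<kappa> \<Lambda>\<close>.
\<close>

lemma clocked_solution_scale:
  assumes sol: "clocked_solution i A c C L \<phi> \<Lambda>" and "0 \<le> L" and "1 \<le> \<kappa>"
  obtains \<theta> \<psi> \<Lambda>' where "clocked_solution i A c (\<kappa> * C) (\<kappa> * L) \<psi> \<Lambda>'"
    and "\<psi> 0 = \<kappa> *\<^sub>R \<phi> 0"
    and "\<And>t. 0 \<le> t \<Longrightarrow> t \<le> \<theta> t" and "\<And>t. 0 \<le> t \<Longrightarrow> \<psi> (\<theta> t) = \<kappa> *\<^sub>R \<phi> t"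
proof -
  define \<theta> where "\<theta> = (\<lambda>t. t + (\<kappa> - 1) * \<Lambda> t)"
  have C: "0 \<le> C" by (rule clocked_solution_error_nonneg[OF sol])
  have \<theta>_incr: "t - s \<le> \<theta> t - \<theta> s" if "0 \<le> s" "s \<le> t" for s t
  proof -
    have "0 \<le> (\<kappa> - 1) * (\<Lambda> t - \<Lambda> s)"
      using clocked_solutionD(2)[OF sol that] \<open>1 \<le> \<kappa>\<close> by simp
    then show ?thesis by (simp add: \<theta>_def algebra_simps)
  qed
  have \<theta>0: "\<theta> 0 = 0" by (simp add: \<theta>_def clocked_solutionD(1)[OF sol])
  have "1-lipschitz_on {0..} \<Lambda>"
  proof (rule lipschitz_onI)
    fix x y :: real assume xy: "x \<in> {0..}" "y \<in> {0..}"
    show "dist (\<Lambda> x) (\<Lambda> y) \<le> 1 * dist x y"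
      using clocked_solutionD(2,3)[OF sol, of x y] clocked_solutionD(2,3)[OF sol, of y x] xy
      by (cases "x \<le> y") (auto simp: dist_real_def)
  qed auto
  then have "continuous_on {0..} \<Lambda>" by (rule lipschitz_on_continuous_on)
  then have cont: "continuous_on {0..} \<theta>" unfolding \<theta>_def by (intro continuous_intros)
  have "\<exists>t\<ge>0. \<theta> t = u" if "0 \<le> u" for u
  proof -
    have "\<exists>t\<ge>0. t \<le> u \<and> \<theta> t = u"
      using \<theta>_incr[of 0 u] that
      by (intro IVT' continuous_on_subset[OF cont]) (auto simp: \<theta>0)
    then show ?thesis by blast
  qed
  then obtain \<sigma> where \<sigma>: "\<And>u. 0 \<le> u \<Longrightarrow> 0 \<le> \<sigma> u" "\<And>u. 0 \<le> u \<Longrightarrow> \<theta> (\<sigma> u) = u" by metis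
  have \<sigma>_mono: "\<sigma> u \<le> \<sigma> v" if "0 \<le> u" "u \<le> v" for u v
    using \<theta>_incr[of "\<sigma> v" "\<sigma> u"] \<sigma>[of u] \<sigma>[of v] that by (cases "\<sigma> u \<le> \<sigma> v") auto
  have \<sigma>\<theta>: "\<sigma> (\<theta> t) = t" if "0 \<le> t" for t
    using \<theta>_incr[of 0 t] \<theta>_incr[of "\<sigma> (\<theta> t)" t] \<theta>_incr[of t "\<sigma> (\<theta> t)"] \<sigma>[of "\<theta> t"] that \<theta>0
    by (cases "\<sigma> (\<theta> t) \<le> t") auto
  define \<psi> where "\<psi> = (\<lambda>u. \<kappa> *\<^sub>R \<phi> (\<sigma> u))"
  define \<Lambda>' where "\<Lambda>' = (\<lambda>u. \<kappa> * \<Lambda> (\<sigma> u))"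
  have sol': "clocked_solution i A c (\<kappa> * C) (\<kappa> * L) \<psi> \<Lambda>'"
    unfolding clocked_solution_def
  proof (intro conjI[of "\<Lambda>' 0 = 0"] allI impI)
    show "\<Lambda>' 0 = 0" using \<sigma>\<theta>[of 0] \<theta>0 by (simp add: \<Lambda>'_def clocked_solutionD(1)[OF sol])
    fix u v :: real assume uv: "0 \<le> u \<and> u \<le> v"
    define s t where "s = \<sigma> u" and "t = \<sigma> v"
    have st: "0 \<le> s" "s \<le> t" using uv \<sigma> \<sigma>_mono by (auto simp: s_def t_def)
    note D = clocked_solutionD(2-)[OF sol st]
    define d where "d = \<Lambda> t - \<Lambda> s"
    have vu: "v - u = (t - s) + (\<kappa> - 1) * d" and le: "t - s \<le> v - u"
      using \<sigma>(2)[of u] \<sigma>(2)[of v] uv \<theta>_incr[OF st]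
      by (auto simp: \<theta>_def s_def t_def d_def algebra_simps)
    have d: "\<Lambda>' v - \<Lambda>' u = \<kappa> * d" by (simp add: \<Lambda>'_def s_def t_def d_def algebra_simps)
    \<comment> \<open>the time spent following \<open>A\<close> is the same before and after rescaling\<close>
    have lag: "v - u - \<kappa> * d = (t - s) - d" using vu by (simp add: algebra_simps)
    have "\<psi> v - \<psi> u - (v - u - \<kappa> * d) *\<^sub>R (A *v \<psi> u) - (\<kappa> * d) *\<^sub>R c
        = \<kappa> *\<^sub>R (\<phi> t - \<phi> s - ((t - s) - d) *\<^sub>R (A *v \<phi> s) - d *\<^sub>R c)"
      unfolding lag by (simp add: \<psi>_def s_def t_def algebra_simps matrix_vector_mult_scaleR)
    then have "norm (\<psi> v - \<psi> u - (v - u - \<kappa> * d) *\<^sub>R (A *v \<psi> u) - (\<kappa> * d) *\<^sub>R c)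
        = \<kappa> * norm (\<phi> t - \<phi> s - ((t - s) - d) *\<^sub>R (A *v \<phi> s) - d *\<^sub>R c)"
      using \<open>1 \<le> \<kappa>\<close> by simp
    also have "\<dots> \<le> \<kappa> * (C * (t - s)\<^sup>2)"
      using D(3) \<open>1 \<le> \<kappa>\<close> by (intro mult_left_mono) (auto simp: d_def)
    also have "\<dots> \<le> \<kappa> * (C * (v - u)\<^sup>2)"
      using C \<open>1 \<le> \<kappa>\<close> le st by (intro mult_left_mono power_mono) auto
    finally have err: "norm (\<psi> v - \<psi> u - (v - u - \<kappa> * d) *\<^sub>R (A *v \<psi> u) - (\<kappa> * d) *\<^sub>R c)
        \<le> \<kappa> * C * (v - u)\<^sup>2" by simp
    have Lle: "\<kappa> * L * (t - s) \<le> \<kappa> * L * (v - u)"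
      using le \<open>0 \<le> L\<close> \<open>1 \<le> \<kappa>\<close> by (intro mult_left_mono) auto
    have pos: "\<kappa> * d = v - u" if "\<kappa> * L * (v - u) < \<psi> u $ i"
    proof -
      have "\<kappa> * (L * (t - s)) < \<kappa> * (\<phi> s $ i)" using that Lle by (simp add: \<psi>_def s_def)
      then have "L * (t - s) < \<phi> s $ i" using \<open>1 \<le> \<kappa>\<close> by simp
      then have "d = t - s" using D(4) by (simp add: d_def)
      then show ?thesis using vu by (simp add: algebra_simps)
    qed
    have neg: "\<kappa> * d = 0" if "\<psi> u $ i < - (\<kappa> * L * (v - u))"
    proof -
      have "\<kappa> * (\<phi> s $ i) < \<kappa> * (- (L * (t - s)))" using that Lle by (simp add: \<psi>_def s_def)
      then have "\<phi> s $ i < - (L * (t - s))" using \<open>1 \<le> \<kappa>\<close> by (subst (asm) mult_less_cancel_left_pos) auto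
      then show ?thesis using D(5) by (simp add: d_def)
    qed
    have "0 \<le> \<kappa> * d" using D(1) \<open>1 \<le> \<kappa>\<close> by (simp add: d_def)
    moreover have "\<kappa> * d \<le> v - u" using D(2) lag by (simp add: d_def)
    ultimately show "0 \<le> \<Lambda>' v - \<Lambda>' u \<and> \<Lambda>' v - \<Lambda>' u \<le> v - u \<and>
      norm (\<psi> v - \<psi> u - (v - u - (\<Lambda>' v - \<Lambda>' u)) *\<^sub>R (A *v \<psi> u) - (\<Lambda>' v - \<Lambda>' u) *\<^sub>R c)
        \<le> \<kappa> * C * (v - u)\<^sup>2 \<and>
      (\<kappa> * L * (v - u) < \<psi> u $ i \<longrightarrow> \<Lambda>' v - \<Lambda>' u = v - u) \<and>
      (\<psi> u $ i < - (\<kappa> * L * (v - u)) \<longrightarrow> \<Lambda>' v - \<Lambda>' u = 0)"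
      unfolding d using err pos neg by (intro conjI impI)
  qed
  have \<psi>0: "\<psi> 0 = \<kappa> *\<^sub>R \<phi> 0" using \<sigma>\<theta>[of 0] \<theta>0 by (simp add: \<psi>_def)
  have \<theta>_ge: "t \<le> \<theta> t" if "0 \<le> t" for t using \<theta>_incr[of 0 t] \<theta>0 that by simp
  have \<psi>\<theta>: "\<psi> (\<theta> t) = \<kappa> *\<^sub>R \<phi> t" if "0 \<le> t" for t using \<sigma>\<theta>[OF that] by (simp add: \<psi>_def)
  show ?thesis by (rule that[OF sol' \<psi>0 \<theta>_ge \<psi>\<theta>])
qed

text \<open>
  The bounded clocked solutions form a compact set in the product topology on functions of time,
  because every defining condition involves only two coordinates and is closed. The
  solutions that stay away from the origin up to time \<open>m\<close> form a decreasing sequence of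
  nonempty closed subsets, so some solution stays away for all time.
\<close>

lemma clocked_solutions_limit:
  fixes N :: "real^'n \<Rightarrow> real"
  assumes N: "is_norm N"
    and approx: "\<And>m::nat. \<exists>\<phi> \<Lambda>. clocked_solution i A c C L \<phi> \<Lambda> \<and> N (\<phi> 0) \<le> r \<and>
      (\<forall>t\<ge>0. norm (\<phi> t) \<le> R) \<and> (\<forall>t. 0 \<le> t \<and> t \<le> real m \<longrightarrow> \<eta> \<le> N (\<phi> t))"
  shows "\<exists>\<phi> \<Lambda>. clocked_solution i A c C L \<phi> \<Lambda> \<and> N (\<phi> 0) \<le> r \<and> (\<forall>t\<ge>0. \<eta> \<le> N (\<phi> t))"
proof -
  define K :: "(real \<Rightarrow> (real^'n) \<times> real) set"
    where "K = (\<Pi>\<^sub>E t\<in>UNIV. cball 0 (max 0 R) \<times> {0..max 0 t})"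
  have "compactin (product_topology (\<lambda>_. euclidean) UNIV) K"
    unfolding K_def compactin_PiE
    by (intro disjI2 ballI) (auto intro!: compact_Times)
  then have K: "compact K" by (simp add: euclidean_product_topology)
  define P :: "(real \<Rightarrow> (real^'n) \<times> real) \<Rightarrow> bool"
    where "P h \<longleftrightarrow> clocked_solution i A c C L (\<lambda>t. fst (h t)) (\<lambda>t. snd (h t)) \<and> N (fst (h 0)) \<le> r" for h
  define X where "X m = {h. P h \<and> (\<forall>t. 0 \<le> t \<and> t \<le> real m \<longrightarrow> \<eta> \<le> N (fst (h t)))}" for m
  have coord: "continuous_on UNIV (\<lambda>h::real \<Rightarrow> (real^'n) \<times> real. h t)" for t
    by (rule continuous_on_product_coordinates)
  have pos: "continuous_on UNIV (\<lambda>h::real \<Rightarrow> (real^'n) \<times> real. fst (h t))" for t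
    by (rule continuous_on_fst[OF coord])
  have clock: "continuous_on UNIV (\<lambda>h::real \<Rightarrow> (real^'n) \<times> real. snd (h t))" for t
    by (rule continuous_on_snd[OF coord])
  have contN: "continuous_on UNIV (\<lambda>h::real \<Rightarrow> (real^'n) \<times> real. N (fst (h t)))" for t
    by (rule continuous_on_compose2[OF is_norm_continuous[OF N, of UNIV] pos]) simp
  have contA: "continuous_on UNIV (\<lambda>h::real \<Rightarrow> (real^'n) \<times> real. A *v fst (h t))" for t
    by (rule bounded_linear.continuous_on[OF matrix_vector_mul_bounded_linear pos])
  have comp: "continuous_on UNIV (\<lambda>h::real \<Rightarrow> (real^'n) \<times> real. fst (h t) $ i)" for t
    by (rule continuous_on_component[OF pos])
  note cont = pos clock contN contA comp continuous_on_const continuous_on_diff continuous_on_scaleR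
    continuous_on_norm
  have closed_X: "closed (X m)" for m
    unfolding X_def P_def clocked_solution_def
    by (intro closed_Collect_conj closed_Collect_all closed_Collect_imp closed_Collect_le
        closed_Collect_eq open_Collect_less open_Collect_const cont)
  have "K \<inter> (\<Inter>m\<in>UNIV. X m) \<noteq> {}"
  proof (rule compact_imp_fip_image[of K UNIV X])
    fix I :: "nat set" assume "finite I"
    define m where "m = Max (insert 0 I)"
    have m: "j \<le> m" if "j \<in> I" for j using \<open>finite I\<close> that by (simp add: m_def)
    obtain \<phi> \<Lambda> where \<phi>: "clocked_solution i A c C L \<phi> \<Lambda>" "N (\<phi> 0) \<le> r"
      "\<And>t. 0 \<le> t \<Longrightarrow> norm (\<phi> t) \<le> R" "\<And>t. 0 \<le> t \<Longrightarrow> t \<le> real m \<Longrightarrow> \<eta> \<le> N (\<phi> t)"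
      using approx[of m] by (elim exE conjE) (auto intro: that)
    \<comment> \<open>negative times carry no condition but must lie in the compact box\<close>
    define h where "h t = (if t < 0 then (0, 0) else (\<phi> t, \<Lambda> t))" for t
    have "h t \<in> cball 0 (max 0 R) \<times> {0..max 0 t}" for t
      using \<phi>(3)[of t] clocked_solutionD(1)[OF \<phi>(1)] clocked_solutionD(2,3)[OF \<phi>(1), of 0 t]
      by (auto simp: h_def)
    then have "h \<in> K" by (auto simp: K_def)
    moreover have "clocked_solution i A c C L (\<lambda>t. fst (h t)) (\<lambda>t. snd (h t))"
      using \<phi>(1) by (auto simp: clocked_solution_def h_def)
    then have "h \<in> X j" if "j \<in> I" for j
      using \<phi>(2,4) m[OF that] by (auto simp: X_def P_def h_def)
    ultimately show "K \<inter> (\<Inter>m\<in>I. X m) \<noteq> {}" by blast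
  qed (use K closed_X in auto)
  then obtain h where "h \<in> (\<Inter>m\<in>UNIV. X m)" by blast
  then have h: "h \<in> X m" for m by blast
  show ?thesis
  proof (intro exI conjI allI impI)
    show "clocked_solution i A c C L (\<lambda>t. fst (h t)) (\<lambda>t. snd (h t))" "N (fst (h 0)) \<le> r"
      using h[of 0] by (auto simp: X_def P_def)
    fix t :: real assume "0 \<le> t"
    obtain m where "t \<le> real m" using real_arch_simple by blast
    then show "\<eta> \<le> N (fst (h t))" using h[of m] \<open>0 \<le> t\<close> by (auto simp: X_def)
  qed
qed

section \<open>From clocked solutions to Filippov solutions\<close>

lemma lipschitz_imp_abs_continuous:
  fixes f :: "real \<Rightarrow> 'a::real_normed_vector"
  assumes lip: "\<And>s t. a \<le> s \<Longrightarrow> s \<le> t \<Longrightarrow> t \<le> b \<Longrightarrow> norm (f t - f s) \<le> K * (t - s)" and "0 \<le> K"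
  shows "abs_continuous_on a b f"
  unfolding abs_continuous_on_def
proof (intro allI impI)
  fix e :: real assume "e > 0"
  show "\<exists>\<delta>>0. \<forall>D T. D division_of T \<and> T \<subseteq> {a..b} \<and> (\<Sum>k\<in>D. Sup k - Inf k) < \<delta> \<longrightarrow>
      (\<Sum>k\<in>D. norm (f (Sup k) - f (Inf k))) < e"
  proof (intro exI[of _ "e / (K + 1)"] conjI allI impI)
    show "0 < e / (K + 1)" using \<open>e > 0\<close> \<open>0 \<le> K\<close> by simp
    fix D T assume D: "D division_of T \<and> T \<subseteq> {a..b} \<and> (\<Sum>k\<in>D. Sup k - Inf k) < e / (K + 1)"
    have ivl: "norm (f (Sup k) - f (Inf k)) \<le> K * (Sup k - Inf k) \<and> 0 \<le> Sup k - Inf k"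
      if "k \<in> D" for k
    proof -
      have "k \<subseteq> {a..b}" "k \<noteq> {}" "\<exists>u v. k = {u..v}"
        using D that division_ofD(2,3)[of D T k] division_ofD(4)[of D T k] by auto
      then obtain u v where "k = {u..v}" "u \<le> v" "a \<le> u" "v \<le> b" by auto
      then show ?thesis using lip[of u v] by simp
    qed
    have "(\<Sum>k\<in>D. norm (f (Sup k) - f (Inf k))) \<le> (\<Sum>k\<in>D. K * (Sup k - Inf k))"
      using ivl by (intro sum_mono) blast
    also have "\<dots> = K * (\<Sum>k\<in>D. Sup k - Inf k)" by (simp add: sum_distrib_left)
    also have "\<dots> \<le> (K + 1) * (\<Sum>k\<in>D. Sup k - Inf k)"
      using ivl by (intro mult_right_mono sum_nonneg) auto
    also have "\<dots> < e" using D \<open>0 \<le> K\<close> by (simp add: field_simps)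
    finally show "(\<Sum>k\<in>D. norm (f (Sup k) - f (Inf k))) < e" .
  qed
qed

text \<open>
  The constant depends on the size of \<open>\<phi>\<close> on \<open>[0, b]\<close>, which the expansion at time 0 controls.
\<close>

lemma clocked_solution_lipschitz:
  fixes A :: "real^'n^'n"
  assumes sol: "clocked_solution i A c C L \<phi> \<Lambda>" and "0 \<le> b"
  obtains K where "0 \<le> K" "\<And>s t. 0 \<le> s \<Longrightarrow> s \<le> t \<Longrightarrow> t \<le> b \<Longrightarrow> norm (\<phi> t - \<phi> s) \<le> K * (t - s)"
proof -
  have C: "0 \<le> C" by (rule clocked_solution_error_nonneg[OF sol])
  have step: "norm (\<phi> t - \<phi> s) \<le> (norm (A *v \<phi> s) + norm c + C * b) * (t - s)"
    if "0 \<le> s" "s \<le> t" "t \<le> b" for s t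
  proof -
    let ?d = "\<Lambda> t - \<Lambda> s"
    have d: "0 \<le> ?d" "?d \<le> t - s" using clocked_solutionD(2,3)[OF sol that(1,2)] by auto
    let ?e = "\<phi> t - \<phi> s - ((t - s) - ?d) *\<^sub>R (A *v \<phi> s) - ?d *\<^sub>R c"
    have "\<phi> t - \<phi> s = ((t - s) - ?d) *\<^sub>R (A *v \<phi> s) + ?d *\<^sub>R c + ?e" by simp
    then have "norm (\<phi> t - \<phi> s) \<le> norm (((t - s) - ?d) *\<^sub>R (A *v \<phi> s)) + norm (?d *\<^sub>R c) + norm ?e"
      by (metis norm_triangle_ineq norm_triangle_mono order_refl)
    also have "\<dots> \<le> (t - s) * norm (A *v \<phi> s) + (t - s) * norm c + C * b * (t - s)"
    proof (intro add_mono)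
      show "norm (((t - s) - ?d) *\<^sub>R (A *v \<phi> s)) \<le> (t - s) * norm (A *v \<phi> s)"
        using d by (simp add: mult_right_mono)
      show "norm (?d *\<^sub>R c) \<le> (t - s) * norm c" using d by (simp add: mult_right_mono)
      have "norm ?e \<le> C * (t - s)\<^sup>2" by (rule clocked_solutionD(4)[OF sol that(1,2)])
      also have "\<dots> \<le> C * (b * (t - s))"
        using that C unfolding power2_eq_square by (intro mult_left_mono mult_right_mono) auto
      finally show "norm ?e \<le> C * b * (t - s)" by simp
    qed
    finally show ?thesis by (simp add: algebra_simps)
  qed
  obtain B where B: "0 \<le> B" "\<And>x. norm (A *v x) \<le> norm x * B"
    using bounded_linear.nonneg_bounded[OF matrix_vector_mul_bounded_linear[of A]] by blast
  define M where "M = norm (\<phi> 0) + (norm (A *v \<phi> 0) + norm c + C * b) * b"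
  define K where "K = M * B + norm c + C * b"
  have M: "norm (\<phi> s) \<le> M" if "0 \<le> s" "s \<le> b" for s
  proof -
    have "norm (\<phi> s) \<le> norm (\<phi> 0) + norm (\<phi> s - \<phi> 0)" by (metis norm_triangle_sub)
    also have "norm (\<phi> s - \<phi> 0) \<le> (norm (A *v \<phi> 0) + norm c + C * b) * s"
      using step[of 0 s] that by simp
    also have "\<dots> \<le> (norm (A *v \<phi> 0) + norm c + C * b) * b"
      using that C by (intro mult_left_mono) auto
    finally show ?thesis by (simp add: M_def)
  qed
  have "norm (\<phi> t - \<phi> s) \<le> K * (t - s)" if "0 \<le> s" "s \<le> t" "t \<le> b" for s t
  proof (rule order_trans[OF step[OF that]])
    have "norm (A *v \<phi> s) \<le> M * B"
      using B(2)[of "\<phi> s"] mult_right_mono[OF M[of s] B(1)] that by linarith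
    then show "(norm (A *v \<phi> s) + norm c + C * b) * (t - s) \<le> K * (t - s)"
      using that by (intro mult_right_mono) (auto simp: K_def)
  qed
  moreover have "0 \<le> M" using M[of 0] \<open>0 \<le> b\<close> norm_ge_zero[of "\<phi> 0"] by linarith
  then have "0 \<le> K" using B(1) C \<open>0 \<le> b\<close> by (simp add: K_def)
  ultimately show ?thesis using that by blast
qed

text \<open>
  The solution differs from its expansion about \<open>t\<close> by a quadratic error. For earlier times the
  definition only offers the expansion about the earlier point; replacing \<open>A \<phi>(y)\<close> by \<open>A \<phi>(t)\<close> costs
  another quadratic term, because \<open>\<phi>\<close> is Lipschitz.
\<close>

lemma clocked_solution_has_vector_derivative:
  fixes A :: "real^'n^'n"
  assumes sol: "clocked_solution i A c C L \<phi> \<Lambda>" and t: "0 < t" "t \<le> b" and "0 \<le> a"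
    and deriv: "(\<Lambda> has_real_derivative g) (at t)"
  shows "(\<phi> has_vector_derivative (1 - g) *\<^sub>R (A *v \<phi> t) + g *\<^sub>R c) (at t within {a..b})"
proof -
  have C: "0 \<le> C" by (rule clocked_solution_error_nonneg[OF sol])
  obtain K where K: "0 \<le> K" "\<And>s t. 0 \<le> s \<Longrightarrow> s \<le> t \<Longrightarrow> t \<le> b \<Longrightarrow> norm (\<phi> t - \<phi> s) \<le> K * (t - s)"
    using clocked_solution_lipschitz[OF sol, of b] t by auto
  obtain B where B: "0 \<le> B" "\<And>x. norm (A *v x) \<le> norm x * B"
    using bounded_linear.nonneg_bounded[OF matrix_vector_mul_bounded_linear[of A]] by blast
  \<comment> \<open>expansion about \<open>t\<close> in the two elapsed times, differentiable wherever the clock is\<close>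
  define p where "p y = \<phi> t + ((y - t) - (\<Lambda> y - \<Lambda> t)) *\<^sub>R (A *v \<phi> t) + (\<Lambda> y - \<Lambda> t) *\<^sub>R c" for y
  define C' where "C' = C + K * B"
  have C': "0 \<le> C'" using C K B by (simp add: C'_def)
  have rem: "norm (\<phi> y - p y) \<le> C' * (y - t)\<^sup>2" if "0 \<le> y" "y \<le> b" for y
  proof (cases "t \<le> y")
    case True
    have "norm (\<phi> y - p y) \<le> C * (y - t)\<^sup>2"
      using clocked_solutionD(4)[OF sol _ True] t by (simp add: p_def algebra_simps)
    also have "\<dots> \<le> C' * (y - t)\<^sup>2" using K B by (intro mult_right_mono) (auto simp: C'_def)
    finally show ?thesis .
  next
    case False
    define d where "d = \<Lambda> t - \<Lambda> y"
    have d: "0 \<le> d" "d \<le> t - y" using clocked_solutionD(2,3)[OF sol, of y t] that False by (auto simp: d_def)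
    have "\<phi> y - p y = - (\<phi> t - \<phi> y - ((t - y) - d) *\<^sub>R (A *v \<phi> y) - d *\<^sub>R c)
        + ((t - y) - d) *\<^sub>R (A *v (\<phi> t - \<phi> y))"
      by (simp add: p_def d_def algebra_simps matrix_vector_mult_diff_distrib)
    then have "norm (\<phi> y - p y) \<le> norm (\<phi> t - \<phi> y - ((t - y) - d) *\<^sub>R (A *v \<phi> y) - d *\<^sub>R c)
        + norm (((t - y) - d) *\<^sub>R (A *v (\<phi> t - \<phi> y)))"
      by (metis norm_minus_cancel norm_triangle_ineq)
    also have "\<dots> \<le> C * (t - y)\<^sup>2 + K * B * (t - y)\<^sup>2"
    proof (rule add_mono)
      show "norm (\<phi> t - \<phi> y - ((t - y) - d) *\<^sub>R (A *v \<phi> y) - d *\<^sub>R c) \<le> C * (t - y)\<^sup>2"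
        using clocked_solutionD(4)[OF sol, of y t] that False by (simp add: d_def)
      have "norm (((t - y) - d) *\<^sub>R (A *v (\<phi> t - \<phi> y))) \<le> (t - y) * (norm (\<phi> t - \<phi> y) * B)"
        using d B by (simp add: mult_mono)
      also have "\<dots> \<le> (t - y) * (K * (t - y) * B)"
        using K(2)[of y t] that t False B by (intro mult_left_mono mult_right_mono) auto
      finally show "norm (((t - y) - d) *\<^sub>R (A *v (\<phi> t - \<phi> y))) \<le> K * B * (t - y)\<^sup>2"
        by (simp add: power2_eq_square mult_ac)
    qed
    also have "\<dots> = C' * (y - t)\<^sup>2" by (simp add: C'_def algebra_simps power2_commute[of t y])
    finally show ?thesis .
  qed
  have "((\<lambda>y. \<phi> y - p y) has_vector_derivative 0) (at t within {a..b})"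
    unfolding has_vector_derivative_def has_derivative_within_alt
  proof (intro conjI allI impI)
    fix e :: real assume "e > 0"
    show "\<exists>d>0. \<forall>y\<in>{a..b}. norm (y - t) < d \<longrightarrow>
      norm (\<phi> y - p y - (\<phi> t - p t) - (y - t) *\<^sub>R 0) \<le> e * norm (y - t)"
    proof (intro exI[of _ "e / (C' + 1)"] conjI ballI impI)
      show "0 < e / (C' + 1)" using \<open>e > 0\<close> C' by simp
      fix y assume y: "y \<in> {a..b}" "norm (y - t) < e / (C' + 1)"
      have "norm (\<phi> y - p y) \<le> C' * \<bar>y - t\<bar> * \<bar>y - t\<bar>"
        using rem[of y] y \<open>0 \<le> a\<close> by (simp add: power2_eq_square)
      also have "C' * \<bar>y - t\<bar> \<le> e" using y(2) C' by (simp add: field_simps)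
      finally show "norm (\<phi> y - p y - (\<phi> t - p t) - (y - t) *\<^sub>R 0) \<le> e * norm (y - t)"
        by (simp add: p_def mult_right_mono)
    qed
  qed (auto intro: bounded_linear_zero)
  moreover have "(p has_vector_derivative (1 - g) *\<^sub>R (A *v \<phi> t) + g *\<^sub>R c) (at t within {a..b})"
  proof -
    have \<Lambda>': "(\<Lambda> has_real_derivative g) (at t within {a..b})"
      using deriv by (rule has_field_derivative_at_within)
    show ?thesis unfolding p_def
      by (auto intro!: derivative_eq_intros \<Lambda>' simp: algebra_simps)
  qed
  ultimately show ?thesis
    using has_vector_derivative_add by fastforce
qed

text \<open>
  Almost everywhere the weight is the derivative of the clock. That it lies in \<open>[0, 1]\<close>, and equals
  1 or 0 off the switching manifold, is seen from the difference quotients to the right, which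
  stay within the times covered by the side conditions.
\<close>

lemma clocked_solution_imp_inclusion_solution:
  fixes A :: "real^'n^'n"
  assumes N: "is_norm N" and sol: "clocked_solution i A c C L \<phi> \<Lambda>"
  shows "inclusion_solution (filippov_map N i (pws_field i A c)) {0..} \<phi>"
proof -
  let ?G = "filippov_map N i (pws_field i A c)"
  \<comment> \<open>extended to negative times by its value at 0, so as to be monotone on the whole line\<close>
  define \<Lambda>0 where "\<Lambda>0 = (\<lambda>t. \<Lambda> (max 0 t))"
  have mono: "\<Lambda>0 s \<le> \<Lambda>0 t" and lip: "\<Lambda>0 t - \<Lambda>0 s \<le> t - s" if "s \<le> t" for s t
    using clocked_solutionD(2,3)[OF sol, of "max 0 s" "max 0 t"] that
    by (auto simp: \<Lambda>0_def max_def split: if_splits)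
  obtain Z g where Z: "negligible Z" "\<And>t. t \<notin> Z \<Longrightarrow> (\<Lambda>0 has_real_derivative g t) (at t)"
    using lipschitz_monotone_differentiable_AE[OF mono lip] by blast
  have good: "(1 - g t) *\<^sub>R (A *v \<phi> t) + g t *\<^sub>R c \<in> ?G (\<phi> t) \<and>
      (\<phi> has_vector_derivative (1 - g t) *\<^sub>R (A *v \<phi> t) + g t *\<^sub>R c) (at t within {a..b})"
    if "0 \<le> a" "0 < t" "t \<in> {a..b}" "t \<notin> Z" for t a b
  proof
    have D0: "(\<Lambda>0 has_real_derivative g t) (at t)" using Z that by blast
    then have "(\<Lambda> has_real_derivative g t) (at t)"
      by (rule has_field_derivative_transform_within_open[of _ _ _ "{0<..}"])
        (use \<open>0 < t\<close> in \<open>auto simp: \<Lambda>0_def\<close>)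
    then show "(\<phi> has_vector_derivative (1 - g t) *\<^sub>R (A *v \<phi> t) + g t *\<^sub>R c) (at t within {a..b})"
      using clocked_solution_has_vector_derivative[OF sol] that by auto
    define q where "q y = (\<Lambda>0 y - \<Lambda>0 t) / (y - t)" for y
    have lim: "(q \<longlongrightarrow> g t) (at_right t)"
      using has_field_derivative_at_within[OF D0, of "{t<..}"]
      by (simp add: has_field_derivative_iff q_def[abs_def])
    have right: "\<forall>\<^sub>F y in at_right t. t < y" by (simp add: eventually_at_filter)
    have near: "\<forall>\<^sub>F y in at_right t. L * (y - t) < m" if "0 < m" for m
    proof -
      have "((\<lambda>y. L * (y - t)) \<longlongrightarrow> L * (t - t)) (at_right t)" by (intro tendsto_intros)
      then show ?thesis using that by (auto dest: order_tendstoD)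
    qed
    have "0 \<le> g t"
    proof (rule tendsto_lowerbound[OF lim _ trivial_limit_at_right_real])
      show "\<forall>\<^sub>F y in at_right t. 0 \<le> q y"
        using right by eventually_elim (use mono in \<open>simp add: q_def\<close>)
    qed
    moreover have "g t \<le> 1"
    proof (rule tendsto_upperbound[OF lim _ trivial_limit_at_right_real])
      show "\<forall>\<^sub>F y in at_right t. q y \<le> 1"
        using right by eventually_elim (use lip in \<open>simp add: q_def\<close>)
    qed
    moreover have "g t = 1" if "0 < \<phi> t $ i"
    proof (rule tendsto_unique[OF trivial_limit_at_right_real lim tendsto_eventually])
      show "\<forall>\<^sub>F y in at_right t. q y = 1"
        using right near[OF that]
      proof eventually_elim
        case (elim y)
        then show ?case using clocked_solutionD(5)[OF sol, of t y] \<open>0 < t\<close> by (simp add: q_def \<Lambda>0_def)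
      qed
    qed
    moreover have "g t = 0" if "\<phi> t $ i < 0"
    proof (rule tendsto_unique[OF trivial_limit_at_right_real lim tendsto_eventually])
      have "0 < - \<phi> t $ i" using that by simp
      show "\<forall>\<^sub>F y in at_right t. q y = 0"
        using right near[OF \<open>0 < - \<phi> t $ i\<close>]
      proof eventually_elim
        case (elim y)
        then show ?case using clocked_solutionD(6)[OF sol, of t y] \<open>0 < t\<close> by (simp add: q_def \<Lambda>0_def)
      qed
    qed
    ultimately show "(1 - g t) *\<^sub>R (A *v \<phi> t) + g t *\<^sub>R c \<in> ?G (\<phi> t)"
      unfolding filippov_map_pws_field[OF N] by (cases "\<phi> t $ i" "0::real" rule: linorder_cases) auto
  qed
  show ?thesis
    unfolding inclusion_solution_def inclusion_solution_compact_def
  proof (intro conjI allI impI)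
    show "is_interval {0::real..}" by (rule is_interval_ci)
    fix a b :: real assume "a \<le> b \<and> {a..b} \<subseteq> {0..}"
    then have ab: "a \<le> b" "0 \<le> a" "0 \<le> b" by auto
    obtain K where "0 \<le> K" "\<And>s t. 0 \<le> s \<Longrightarrow> s \<le> t \<Longrightarrow> t \<le> b \<Longrightarrow> norm (\<phi> t - \<phi> s) \<le> K * (t - s)"
      using clocked_solution_lipschitz[OF sol \<open>0 \<le> b\<close>] by blast
    then show "abs_continuous_on a b \<phi>"
      using ab by (intro lipschitz_imp_abs_continuous[of a b \<phi> K]) auto
    have "negligible (insert 0 Z)" using Z by simp
    then have "AE t in lebesgue. t \<notin> insert 0 Z"
      by (intro AE_not_in) (simp add: negligible_iff_null_sets)
    then have "AE t in lebesgue. t \<in> {a..b} \<longrightarrow>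
        (\<exists>v\<in>?G (\<phi> t). (\<phi> has_vector_derivative v) (at t within {a..b}))"
    proof eventually_elim
      case (elim t)
      show ?case
      proof
        assume "t \<in> {a..b}"
        then show "\<exists>v\<in>?G (\<phi> t). (\<phi> has_vector_derivative v) (at t within {a..b})"
          using good[of a t b] elim ab by force
      qed
    qed
    then show "AE t in lebesgue_on {a..b}. \<exists>v\<in>?G (\<phi> t). (\<phi> has_vector_derivative v) (at t within {a..b})"
      by (subst AE_restrict_space_iff) auto
  qed
qed

section \<open>From Filippov solutions to clocked solutions\<close>

text \<open>
  Solutions are given on compact intervals, with one-sided derivatives at the ends; countably many
  intervals exhaust the half-line with a single null set.
\<close>

lemma inclusion_solution_derivative:
  assumes sol: "inclusion_solution G {0..} \<phi>"
  obtains Z where "negligible Z"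
    and "\<And>t. 0 < t \<Longrightarrow> t \<notin> Z \<Longrightarrow> \<exists>v\<in>G (\<phi> t). (\<phi> has_vector_derivative v) (at t)"
proof -
  let ?P = "\<lambda>t. \<exists>v\<in>G (\<phi> t). (\<phi> has_vector_derivative v) (at t)"
  have "AE t in lebesgue. \<forall>n::nat. t \<in> {0<..<real n} \<longrightarrow> ?P t"
  proof (subst AE_all_countable, rule allI)
    fix n :: nat
    have "inclusion_solution_compact G 0 (real n) \<phi>"
      using sol unfolding inclusion_solution_def by auto
    then have "AE t in lebesgue_on {0..real n}.
        \<exists>v\<in>G (\<phi> t). (\<phi> has_vector_derivative v) (at t within {0..real n})"
      unfolding inclusion_solution_compact_def by blast
    then have "AE t in lebesgue. t \<in> {0..real n} \<longrightarrow>
        (\<exists>v\<in>G (\<phi> t). (\<phi> has_vector_derivative v) (at t within {0..real n}))"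
      by (subst (asm) AE_restrict_space_iff) auto
    then show "AE t in lebesgue. t \<in> {0<..<real n} \<longrightarrow> ?P t"
      by eventually_elim (auto simp: at_within_Icc_at)
  qed
  then obtain Z where Z: "Z \<in> null_sets lebesgue"
    "{t. \<not> (\<forall>n::nat. t \<in> {0<..<real n} \<longrightarrow> ?P t)} \<subseteq> Z"
    unfolding eventually_ae_filter by auto
  show ?thesis
  proof (rule that)
    show "negligible Z" using Z(1) by (simp add: negligible_iff_null_sets)
    fix t :: real assume "0 < t" "t \<notin> Z"
    obtain n where "t < real n" using reals_Archimedean2 by blast
    then show "?P t" using Z(2) \<open>0 < t\<close> \<open>t \<notin> Z\<close> by fastforce
  qed
qed

text \<open>
  The weight of \<open>c\<close> in a velocity \<open>v\<close> of the Filippov map at \<open>x\<close>, as an explicit and hence measurable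
  function of \<open>v\<close>. On the switching manifold it is the coordinate of \<open>v\<close> along the segment from \<open>A x\<close>
  to \<open>c\<close>. The segment may degenerate to a point, where every weight is correct and division by
  zero selects 0.
\<close>

definition sliding_weight :: "'n \<Rightarrow> real^'n^'n \<Rightarrow> real^'n \<Rightarrow> real^'n \<Rightarrow> real^'n \<Rightarrow> real" where
  "sliding_weight i A c x v =
     (if 0 < x $ i then 1 else if x $ i < 0 then 0
      else max 0 (min 1 ((v - A *v x) \<bullet> (c - A *v x) / ((c - A *v x) \<bullet> (c - A *v x)))))"

lemma sliding_weight_bounds: "0 \<le> sliding_weight i A c x v" "sliding_weight i A c x v \<le> 1"
  by (auto simp: sliding_weight_def)

lemma sliding_weight_velocity:
  fixes A :: "real^'n^'n"
  assumes N: "is_norm N" and v: "v \<in> filippov_map N i (pws_field i A c) x"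
  shows "v = (1 - sliding_weight i A c x v) *\<^sub>R (A *v x) + sliding_weight i A c x v *\<^sub>R c"
proof (cases "x $ i = 0")
  case True
  then obtain u where u: "0 \<le> u" "u \<le> 1" "v = (1 - u) *\<^sub>R (A *v x) + u *\<^sub>R c"
    using v unfolding filippov_map_pws_field[OF N] by auto
  show ?thesis
  proof (cases "A *v x = c")
    case True
    then show ?thesis using u(3) by (simp flip: scaleR_left.add)
  next
    case False
    have "v - A *v x = u *\<^sub>R (c - A *v x)" using u(3) by (simp add: algebra_simps)
    then have "sliding_weight i A c x v = u"
      using u(1,2) False \<open>x $ i = 0\<close> by (simp add: sliding_weight_def)
    then show ?thesis using u(3) by simp
  qed
next
  case False
  then show ?thesis using v unfolding filippov_map_pws_field[OF N]
    by (auto simp: sliding_weight_def split: if_splits)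
qed

text \<open>
  The derivative of an absolutely continuous function is integrable, so the weight is measurable
  and its integral serves as the clock. The constants depend on the bound \<open>R\<close> alone, which
  makes a whole family of solutions amenable to one compactness argument.
\<close>

lemma inclusion_solution_imp_clocked_solution:
  fixes A :: "real^'n^'n"
  assumes N: "is_norm N" and "0 \<le> R"
  obtains C L where "0 \<le> L"
    and "\<And>\<phi>. inclusion_solution (filippov_map N i (pws_field i A c)) {0..} \<phi> \<Longrightarrow>
      (\<And>t. 0 \<le> t \<Longrightarrow> norm (\<phi> t) \<le> R) \<Longrightarrow> \<exists>\<Lambda>. clocked_solution i A c C L \<phi> \<Lambda>"
proof -
  let ?G = "filippov_map N i (pws_field i A c)"
  obtain B where B: "0 \<le> B" "\<And>x. norm (A *v x) \<le> norm x * B"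
    using bounded_linear.nonneg_bounded[OF matrix_vector_mul_bounded_linear[of A]] by blast
  define L where "L = R * B + norm c"
  have L: "0 \<le> L" using B(1) \<open>0 \<le> R\<close> by (simp add: L_def)
  have "\<exists>\<Lambda>. clocked_solution i A c (L * B) L \<phi> \<Lambda>"
    if sol: "inclusion_solution ?G {0..} \<phi>" and bound: "\<And>t. 0 \<le> t \<Longrightarrow> norm (\<phi> t) \<le> R" for \<phi>
  proof -
    obtain Z where Z: "negligible Z"
      "\<And>t. 0 < t \<Longrightarrow> t \<notin> Z \<Longrightarrow> \<exists>v\<in>?G (\<phi> t). (\<phi> has_vector_derivative v) (at t)"
      using inclusion_solution_derivative[OF sol] by blast
    define D where "D t = (if 0 < t \<and> t \<notin> Z then vector_derivative \<phi> (at t) else 0)" for t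
    define w where "w t = sliding_weight i A c (\<phi> t) (D t)" for t
    have w01: "0 \<le> w t" "w t \<le> 1" for t by (simp_all add: w_def sliding_weight_bounds)
    have D: "(\<phi> has_vector_derivative D t) (at t)" "D t = (1 - w t) *\<^sub>R (A *v \<phi> t) + w t *\<^sub>R c"
      if "0 < t" "t \<notin> Z" for t
    proof -
      obtain v where v: "v \<in> ?G (\<phi> t)" "(\<phi> has_vector_derivative v) (at t)"
        using Z(2)[OF \<open>0 < t\<close> \<open>t \<notin> Z\<close>] by blast
      then have "D t = v" using \<open>0 < t\<close> \<open>t \<notin> Z\<close> by (simp add: D_def vector_derivative_at)
      then show "(\<phi> has_vector_derivative D t) (at t)"
        "D t = (1 - w t) *\<^sub>R (A *v \<phi> t) + w t *\<^sub>R c"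
        using v sliding_weight_velocity[OF N v(1)] by (simp_all add: w_def)
    qed
    have Z0: "negligible (insert 0 Z)" using Z(1) by simp
    have int_D: "(D has_integral (\<phi> t - \<phi> s)) {s..t}" if "0 \<le> s" "s \<le> t" for s t
    proof (rule abs_continuous_has_integral[OF \<open>s \<le> t\<close> _ Z0])
      show "abs_continuous_on s t \<phi>"
        using sol that unfolding inclusion_solution_def inclusion_solution_compact_def by auto
      fix x assume "x \<in> {s..t} - insert 0 Z"
      then show "(\<phi> has_vector_derivative D x) (at x within {s..t})"
        using D(1)[of x] that by (auto intro: has_vector_derivative_at_within)
    qed
    have D_bound: "norm (D t) \<le> L" for t
    proof (cases "0 < t \<and> t \<notin> Z")
      case True
      have "norm (D t) \<le> (1 - w t) * norm (A *v \<phi> t) + w t * norm c"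
        unfolding D(2)[OF conjunct1[OF True] conjunct2[OF True]]
        using norm_triangle_ineq[of "(1 - w t) *\<^sub>R (A *v \<phi> t)" "w t *\<^sub>R c"] w01[of t] by simp
      also have "\<dots> \<le> 1 * norm (A *v \<phi> t) + 1 * norm c"
        using w01[of t] by (intro add_mono mult_right_mono) auto
      also have "\<dots> \<le> L"
        using B(2)[of "\<phi> t"] mult_right_mono[OF bound[of t] B(1)] True by (simp add: L_def)
      finally show ?thesis .
    next
      case False
      then have "D t = 0" by (auto simp: D_def)
      then show ?thesis using L by simp
    qed
    have lip: "norm (\<phi> t - \<phi> s) \<le> L * (t - s)" if "0 \<le> s" "s \<le> t" for s t
      using has_integral_bound_real[OF L _ int_D[OF that], of "{}"] D_bound that by simp
    have int_w: "w integrable_on {s..t}" if "0 \<le> s" "s \<le> t" for s t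
    proof (rule measurable_bounded_by_integrable_imp_integrable)
      have "L-lipschitz_on {s..t} \<phi>"
      proof (rule lipschitz_onI)
        fix x y assume "x \<in> {s..t}" "y \<in> {s..t}"
        then show "dist (\<phi> x) (\<phi> y) \<le> L * dist x y"
          using lip[of x y] lip[of y x] that
          by (cases "x \<le> y") (auto simp: dist_norm norm_minus_commute)
      qed (rule L)
      then have cont: "continuous_on {s..t} \<phi>" by (rule lipschitz_on_continuous_on)
      have [measurable]: "\<phi> \<in> borel_measurable (lebesgue_on {s..t})"
        "(\<lambda>t. A *v \<phi> t) \<in> borel_measurable (lebesgue_on {s..t})"
        "(\<lambda>t. \<phi> t $ i) \<in> borel_measurable (lebesgue_on {s..t})"
        by (intro continuous_imp_measurable_on_sets_lebesgue continuous_on_component cont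
            bounded_linear.continuous_on[OF matrix_vector_mul_bounded_linear]; simp)+
      have [measurable]: "D \<in> borel_measurable (lebesgue_on {s..t})"
        using int_D[OF that] by (intro integrable_imp_measurable) (rule has_integral_integrable)
      show "w \<in> borel_measurable (lebesgue_on {s..t})"
        unfolding w_def sliding_weight_def by measurable
      show "(\<lambda>_. 1::real) integrable_on {s..t}" by (rule integrable_const_ivl)
    qed (use w01 in auto)
    define \<Lambda> where "\<Lambda> t = integral {0..t} w" for t
    have \<Lambda>: "\<Lambda> t - \<Lambda> s = integral {s..t} w" if "0 \<le> s" "s \<le> t" for s t
      using Henstock_Kurzweil_Integration.integral_combine[OF that int_w] that
      by (simp add: \<Lambda>_def)
    have "clocked_solution i A c (L * B) L \<phi> \<Lambda>"
      unfolding clocked_solution_def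
    proof (intro conjI[of "\<Lambda> 0 = 0"] allI impI)
      show "\<Lambda> 0 = 0" by (simp add: \<Lambda>_def)
      fix s t :: real assume "0 \<le> s \<and> s \<le> t"
      then have st: "0 \<le> s" "s \<le> t" by auto
      note int = int_w[OF st]
      have "0 \<le> integral {s..t} w" using w01 by (intro Henstock_Kurzweil_Integration.integral_nonneg int) auto
      moreover have "integral {s..t} w \<le> integral {s..t} (\<lambda>_. 1)"
        using w01 by (intro integral_le int integrable_const_ivl) auto
      then have "integral {s..t} w \<le> t - s" using st by simp
      moreover have "norm (\<phi> t - \<phi> s - ((t - s) - integral {s..t} w) *\<^sub>R (A *v \<phi> s)
          - integral {s..t} w *\<^sub>R c) \<le> L * B * (t - s)\<^sup>2"
      proof -
        \<comment> \<open>\<open>E u\<close> is \<open>(1 - w u) *\<^sub>R (A *v (\<phi> u - \<phi> s))\<close> almost everywhere, of order \<open>u - s\<close>\<close>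
        let ?E = "\<lambda>u. D u - (1 - w u) *\<^sub>R (A *v \<phi> s) - w u *\<^sub>R c"
        define E where "E u = (if u \<in> insert 0 Z then 0 else ?E u)" for u
        have W: "(w has_integral integral {s..t} w) {s..t}" using int by (rule integrable_integral)
        have one: "((\<lambda>u. 1) has_integral (t - s)) {s..t}"
          using has_integral_const_real[of "1::real" s t] st by simp
        have "(?E has_integral (\<phi> t - \<phi> s - ((t - s) - integral {s..t} w) *\<^sub>R (A *v \<phi> s)
          - integral {s..t} w *\<^sub>R c)) {s..t}"
          by (intro has_integral_diff has_integral_scaleR_left int_D st W one)
        then have "(E has_integral (\<phi> t - \<phi> s - ((t - s) - integral {s..t} w) *\<^sub>R (A *v \<phi> s)
          - integral {s..t} w *\<^sub>R c)) {s..t}"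
          by (rule has_integral_spike[OF Z0, rotated]) (auto simp: E_def)
        moreover have "norm (E u) \<le> L * B * (t - s)" if u: "u \<in> {s..t}" for u
        proof (cases "u \<in> insert 0 Z")
          case True
          then show ?thesis using L B st by (simp add: E_def)
        next
          case False
          then have "E u = (1 - w u) *\<^sub>R (A *v (\<phi> u - \<phi> s))"
            using D(2)[of u] u st by (simp add: E_def algebra_simps matrix_vector_mult_diff_distrib)
          then have "norm (E u) \<le> 1 * norm (A *v (\<phi> u - \<phi> s))"
            using w01[of u] by (auto intro: mult_left_le_one_le)
          also have "\<dots> \<le> norm (\<phi> u - \<phi> s) * B" using B(2)[of "\<phi> u - \<phi> s"] by simp
          also have "\<dots> \<le> L * (t - s) * B"
            using lip[of s u] u st L mult_left_mono[of "u - s" "t - s" L] B(1)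
            by (intro mult_right_mono) auto
          finally show ?thesis by (simp add: mult_ac)
        qed
        ultimately have "norm (\<phi> t - \<phi> s - ((t - s) - integral {s..t} w) *\<^sub>R (A *v \<phi> s)
          - integral {s..t} w *\<^sub>R c) \<le> L * B * (t - s) * measure lborel {s..t}"
          using has_integral_bound_real[of "L * B * (t - s)" "{}" E _ s t] L B st by simp
        then show ?thesis using st by (simp add: power2_eq_square)
      qed
      moreover have comp: "\<bar>\<phi> u $ i - \<phi> s $ i\<bar> \<le> L * (t - s)" if "u \<in> {s..t}" for u
      proof -
        have "\<bar>\<phi> u $ i - \<phi> s $ i\<bar> \<le> norm (\<phi> u - \<phi> s)"
          using component_le_norm_cart[of "\<phi> u - \<phi> s" i] by simp
        also have "\<dots> \<le> L * (u - s)" using lip[of s u] that st by simp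
        also have "\<dots> \<le> L * (t - s)" using that L by (intro mult_left_mono) auto
        finally show ?thesis .
      qed
      have "integral {s..t} w = t - s" if "L * (t - s) < \<phi> s $ i"
      proof -
        have "w u = 1" if "u \<in> {s..t}" for u
          using comp[OF that] \<open>L * (t - s) < \<phi> s $ i\<close> by (auto simp: w_def sliding_weight_def)
        then have "integral {s..t} w = integral {s..t} (\<lambda>_. 1)" by (intro integral_cong) auto
        then show ?thesis using st by simp
      qed
      moreover have "integral {s..t} w = 0" if "\<phi> s $ i < - (L * (t - s))"
      proof -
        have "w u = 0" if "u \<in> {s..t}" for u
          using comp[OF that] \<open>\<phi> s $ i < - (L * (t - s))\<close> by (auto simp: w_def sliding_weight_def)
        then have "integral {s..t} w = integral {s..t} (\<lambda>_. 0)" by (intro integral_cong) auto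
        then show ?thesis by simp
      qed
      ultimately show "0 \<le> \<Lambda> t - \<Lambda> s \<and> \<Lambda> t - \<Lambda> s \<le> t - s \<and>
        norm (\<phi> t - \<phi> s - ((t - s) - (\<Lambda> t - \<Lambda> s)) *\<^sub>R (A *v \<phi> s) - (\<Lambda> t - \<Lambda> s) *\<^sub>R c)
          \<le> L * B * (t - s)\<^sup>2 \<and>
        (L * (t - s) < \<phi> s $ i \<longrightarrow> \<Lambda> t - \<Lambda> s = t - s) \<and>
        (\<phi> s $ i < - (L * (t - s)) \<longrightarrow> \<Lambda> t - \<Lambda> s = 0)"
        unfolding \<Lambda>[OF st] by (intro conjI impI)
    qed
    then show ?thesis by blast
  qed
  then show ?thesis using that L by blast
qed

section \<open>Stability\<close>

lemma is_norm_simps: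
  assumes "is_norm N"
  shows "0 \<le> N x" "N 0 = 0" "N (r *\<^sub>R x) = \<bar>r\<bar> * N x" "N (- x) = N x" "N (x - y) = N (y - x)"
proof -
  show s: "N (r *\<^sub>R x) = \<bar>r\<bar> * N x" for r x using assms by (simp add: is_norm_def)
  show m: "N (- x) = N x" for x using s[of "-1" x] by simp
  show "N (x - y) = N (y - x)" using m[of "x - y"] by simp
qed (use assms in \<open>auto simp: is_norm_def\<close>)

lemma exponentially_stable_imp_asymptotically_stable:
  fixes N :: "'a::euclidean_space \<Rightarrow> real"
  assumes N: "is_norm N" and exp: "exponentially_stable N G p"
  shows "asymptotically_stable N G p"
proof -
  obtain \<alpha> \<beta> \<delta> where pos: "1 \<le> \<alpha>" "0 < \<beta>" "0 < \<delta>"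
    and decay: "\<forall>I \<phi>. forward_maximal_solution G I \<phi> \<and> 0 \<in> I \<and> \<phi> 0 \<in> norm_ball N p \<delta> \<longrightarrow>
      {0..} \<subseteq> I \<and> (\<forall>t\<ge>0. N (\<phi> t - p) \<le> \<alpha> * exp (- \<beta> * t) * N (\<phi> 0 - p))"
    using exp unfolding exponentially_stable_def by blast
  have ball: "x \<in> norm_ball N p d \<longleftrightarrow> N (x - p) < d" for x d
    by (simp add: norm_ball_def is_norm_simps(5)[OF N, of p x])
  have stable: "\<exists>d>0. \<forall>I \<phi>. forward_maximal_solution G I \<phi> \<and> 0 \<in> I \<and> \<phi> 0 \<in> norm_ball N p d \<longrightarrow>
      {0..} \<subseteq> I \<and> (\<forall>t\<ge>0. \<phi> t \<in> norm_ball N p \<epsilon>)" if "0 < \<epsilon>" for \<epsilon>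
  proof (intro exI[of _ "min \<delta> (\<epsilon> / \<alpha>)"] conjI allI impI)
    show "0 < min \<delta> (\<epsilon> / \<alpha>)" using pos that by simp
    fix I \<phi> assume *: "forward_maximal_solution G I \<phi> \<and> 0 \<in> I \<and> \<phi> 0 \<in> norm_ball N p (min \<delta> (\<epsilon> / \<alpha>))"
    then have start: "N (\<phi> 0 - p) < \<epsilon> / \<alpha>" and d: "{0..} \<subseteq> I"
      "\<And>t. 0 \<le> t \<Longrightarrow> N (\<phi> t - p) \<le> \<alpha> * exp (- \<beta> * t) * N (\<phi> 0 - p)"
      using decay[rule_format, of I \<phi>] by (auto simp: ball)
    show "{0..} \<subseteq> I" by (rule d)
    fix t :: real assume "0 \<le> t"
    have "N (\<phi> t - p) \<le> \<alpha> * exp (- \<beta> * t) * N (\<phi> 0 - p)" by (rule d(2)[OF \<open>0 \<le> t\<close>])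
    also have "\<dots> \<le> \<alpha> * 1 * N (\<phi> 0 - p)"
      using pos \<open>0 \<le> t\<close> is_norm_simps(1)[OF N] by (intro mult_right_mono mult_left_mono) auto
    also have "\<dots> < \<epsilon>" using start pos by (simp add: field_simps)
    finally show "\<phi> t \<in> norm_ball N p \<epsilon>" by (simp add: ball)
  qed
  obtain k where k: "k > 0" "\<And>x. k * norm x \<le> N x" using is_norm_bounded_below[OF N] by blast
  have attractive: "(\<phi> \<longlongrightarrow> p) at_top"
    if d: "\<forall>t\<ge>0. N (\<phi> t - p) \<le> \<alpha> * exp (- \<beta> * t) * N (\<phi> 0 - p)" for \<phi>
  proof -
    have "((\<lambda>t. \<alpha> * exp (- \<beta> * t) * N (\<phi> 0 - p) / k) \<longlongrightarrow> \<alpha> * 0 * N (\<phi> 0 - p) / k) at_top"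
      using pos k(1)
      by (intro tendsto_intros filterlim_compose[OF exp_at_bot]
          filterlim_tendsto_neg_mult_at_bot[OF tendsto_const _ filterlim_ident]) auto
    then have "((\<lambda>t. \<alpha> * exp (- \<beta> * t) * N (\<phi> 0 - p) / k) \<longlongrightarrow> 0) at_top" by simp
    moreover have "\<forall>\<^sub>F t in at_top. norm (\<phi> t - p) \<le> \<alpha> * exp (- \<beta> * t) * N (\<phi> 0 - p) / k"
      using eventually_ge_at_top[of 0]
    proof eventually_elim
      case (elim t)
      then have "k * norm (\<phi> t - p) \<le> \<alpha> * exp (- \<beta> * t) * N (\<phi> 0 - p)"
        using d k(2)[of "\<phi> t - p"] by (meson order_trans)
      then show ?case using k(1) by (simp add: field_simps)
    qed
    ultimately have "((\<lambda>t. \<phi> t - p) \<longlongrightarrow> 0) at_top"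
      by (rule Lim_null_comparison[rotated])
    then show ?thesis by (simp add: LIM_zero_iff)
  qed
  show ?thesis
    unfolding asymptotically_stable_def lyapunov_stable_def
  proof (intro conjI allI impI)
    show "is_equilibrium G p" using exp by (simp add: exponentially_stable_def)
    show "\<exists>d>0. \<forall>I \<phi>. forward_maximal_solution G I \<phi> \<and> 0 \<in> I \<and> \<phi> 0 \<in> norm_ball N p d \<longrightarrow>
      {0..} \<subseteq> I \<and> (\<forall>t\<ge>0. \<phi> t \<in> norm_ball N p \<epsilon>)" if "0 < \<epsilon>" for \<epsilon>
      by (rule stable[OF that])
    show "\<exists>d>0. \<forall>I \<phi>. forward_maximal_solution G I \<phi> \<and> 0 \<in> I \<and> \<phi> 0 \<in> norm_ball N p d \<longrightarrow>
      {0..} \<subseteq> I \<and> (\<phi> \<longlongrightarrow> p) at_top"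
    proof (intro exI[of _ \<delta>] conjI allI impI)
      show "0 < \<delta>" by (rule pos)
      fix I \<phi> assume "forward_maximal_solution G I \<phi> \<and> 0 \<in> I \<and> \<phi> 0 \<in> norm_ball N p \<delta>"
      then have *: "{0..} \<subseteq> I \<and> (\<forall>t\<ge>0. N (\<phi> t - p) \<le> \<alpha> * exp (- \<beta> * t) * N (\<phi> 0 - p))"
        using decay by blast
      show "{0..} \<subseteq> I" by (rule conjunct1[OF *])
      show "(\<phi> \<longlongrightarrow> p) at_top" by (rule attractive[OF conjunct2[OF *]])
    qed
  qed
qed

text \<open>
  A solution on an interval that is unbounded to the right is maximal for trivial reasons, so the
  stability hypotheses apply to it without any extension argument.
\<close>

lemma half_line_solution_forward_maximal:
  assumes "inclusion_solution G {0..} \<phi>"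
  shows "forward_maximal_solution G {0..} \<phi>"
proof -
  have "\<exists>t\<in>{0..}. s \<le> t" for s :: real by (rule bexI[of _ "max 0 s"]) auto
  then show ?thesis using assms by (simp add: forward_maximal_solution_def)
qed

lemma forward_maximal_solution_on_half_line:
  assumes "forward_maximal_solution G I \<phi>" and "{0..} \<subseteq> I"
  shows "inclusion_solution G {0..} \<phi>"
proof -
  have "inclusion_solution G I \<phi>" using assms(1) by (simp add: forward_maximal_solution_def)
  then have "inclusion_solution_compact G a b \<phi>" if "a \<le> b" "{a..b} \<subseteq> {0..}" for a b
    using assms(2) that unfolding inclusion_solution_def by blast
  then show ?thesis
    unfolding inclusion_solution_def by (simp add: is_interval_ci)
qed

lemma inclusion_solution_shift:
  fixes A :: "real^'n^'n"
  assumes N: "is_norm N" and sol: "inclusion_solution (filippov_map N i (pws_field i A c)) {0..} \<phi>"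
    and bound: "\<And>t. 0 \<le> t \<Longrightarrow> norm (\<phi> t) \<le> R" and "0 \<le> a"
  shows "inclusion_solution (filippov_map N i (pws_field i A c)) {0..} (\<lambda>t. \<phi> (t + a))"
proof -
  have "0 \<le> R" using bound[of 0] norm_ge_zero[of "\<phi> 0"] by linarith
  then obtain C L \<Lambda> where "clocked_solution i A c C L \<phi> \<Lambda>"
    using inclusion_solution_imp_clocked_solution[OF N, of R i A c] sol bound by metis
  then show ?thesis
    using clocked_solution_shift[OF _ \<open>0 \<le> a\<close>] clocked_solution_imp_inclusion_solution[OF N] by blast
qed

text \<open>
  This replaces the homogeneity of linear systems. Of the time change only \<open>t \<le> \<theta> t\<close> is kept: it
  carries bounds at late times over from \<open>\<psi>\<close> to \<open>\<phi>\<close>.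
\<close>

lemma inclusion_solution_scale:
  fixes A :: "real^'n^'n"
  assumes N: "is_norm N" and sol: "inclusion_solution (filippov_map N i (pws_field i A c)) {0..} \<phi>"
    and bound: "\<And>t. 0 \<le> t \<Longrightarrow> norm (\<phi> t) \<le> R" and "1 \<le> \<kappa>"
  obtains \<theta> \<psi> where "inclusion_solution (filippov_map N i (pws_field i A c)) {0..} \<psi>"
    and "\<psi> 0 = \<kappa> *\<^sub>R \<phi> 0"
    and "\<And>t. 0 \<le> t \<Longrightarrow> t \<le> \<theta> t" and "\<And>t. 0 \<le> t \<Longrightarrow> \<psi> (\<theta> t) = \<kappa> *\<^sub>R \<phi> t"
proof -
  have "0 \<le> R" using bound[of 0] norm_ge_zero[of "\<phi> 0"] by linarith
  then obtain C L \<Lambda> where "0 \<le> L" "clocked_solution i A c C L \<phi> \<Lambda>"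
    using inclusion_solution_imp_clocked_solution[OF N, of R i A c] sol bound by metis
  then obtain \<theta> \<psi> \<Lambda>' where s: "clocked_solution i A c (\<kappa> * C) (\<kappa> * L) \<psi> \<Lambda>'" "\<psi> 0 = \<kappa> *\<^sub>R \<phi> 0"
    "\<And>t. 0 \<le> t \<Longrightarrow> t \<le> \<theta> t" "\<And>t. 0 \<le> t \<Longrightarrow> \<psi> (\<theta> t) = \<kappa> *\<^sub>R \<phi> t"
    using clocked_solution_scale[OF _ _ \<open>1 \<le> \<kappa>\<close>] by metis
  show ?thesis
    by (rule that[OF clocked_solution_imp_inclusion_solution[OF N s(1)] s(2-)])
qed

text \<open>
  Attractivity gives a time for each solution. If no common time for entering the
  neighbourhood given by Lyapunov stability existed, a limit of slower and slower solutions would be a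
  solution that never enters it, contradicting attractivity. After entering, the solution stays
  small by Lyapunov stability.
\<close>

lemma asymptotically_stable_uniform:
  fixes A :: "real^'n^'n"
  assumes N: "is_norm N" and stable: "asymptotically_stable N (filippov_map N i (pws_field i A c)) 0"
  obtains r T where "0 < r" and "0 < T"
    and "\<forall>I \<phi>. forward_maximal_solution (filippov_map N i (pws_field i A c)) I \<phi> \<and> 0 \<in> I \<and>
      N (\<phi> 0) < r \<longrightarrow> {0..} \<subseteq> I"
    and "\<forall>\<phi>. inclusion_solution (filippov_map N i (pws_field i A c)) {0..} \<phi> \<and> N (\<phi> 0) \<le> r \<longrightarrow>
      (\<forall>t\<ge>0. N (\<phi> t) \<le> 1) \<and> (\<forall>t\<ge>T. N (\<phi> t) \<le> r / 2)"
proof -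
  let ?G = "filippov_map N i (pws_field i A c)"
  have ball: "x \<in> norm_ball N 0 d \<longleftrightarrow> N x < d" for x :: "real^'n" and d
    by (simp add: norm_ball_def is_norm_simps(4)[OF N])
  have lyap: "\<exists>d>0. (\<forall>I \<phi>. forward_maximal_solution ?G I \<phi> \<and> 0 \<in> I \<and> N (\<phi> 0) < d \<longrightarrow>
      {0..} \<subseteq> I \<and> (\<forall>t\<ge>0. N (\<phi> t) < \<epsilon>))" if "0 < \<epsilon>" for \<epsilon>
    using stable that unfolding asymptotically_stable_def lyapunov_stable_def ball by blast
  obtain \<delta>1 where "0 < \<delta>1" and lyap1: "\<forall>I \<phi>. forward_maximal_solution ?G I \<phi> \<and> 0 \<in> I \<and> N (\<phi> 0) < \<delta>1 \<longrightarrow>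
      {0..} \<subseteq> I \<and> (\<forall>t\<ge>0. N (\<phi> t) < 1)"
    using lyap[OF zero_less_one] by blast
  obtain \<delta>2 where "0 < \<delta>2" and attr: "\<forall>I \<phi>. forward_maximal_solution ?G I \<phi> \<and> 0 \<in> I \<and> N (\<phi> 0) < \<delta>2 \<longrightarrow>
      {0..} \<subseteq> I \<and> (\<phi> \<longlongrightarrow> 0) at_top"
    using stable unfolding asymptotically_stable_def ball by blast
  define r where "r = min \<delta>1 \<delta>2 / 2"
  have r: "0 < r" "r < \<delta>1" "r < \<delta>2" using \<open>0 < \<delta>1\<close> \<open>0 < \<delta>2\<close> by (auto simp: r_def)
  have "0 < r / 2" using r(1) by simp
  from lyap[OF this] obtain \<eta> where "0 < \<eta>" and lyap\<eta>: "\<forall>I \<phi>. forward_maximal_solution ?G I \<phi> \<and> 0 \<in> I \<and> N (\<phi> 0) < \<eta> \<longrightarrow>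
      {0..} \<subseteq> I \<and> (\<forall>t\<ge>0. N (\<phi> t) < r / 2)"
    by blast
  obtain k where k: "k > 0" "\<And>x. k * norm x \<le> N x" using is_norm_bounded_below[OF N] by blast
  have below1: "N (\<phi> t) < 1" if "inclusion_solution ?G {0..} \<phi>" "N (\<phi> 0) \<le> r" "0 \<le> t" for \<phi> t
    using lyap1[rule_format, of "{0..}" \<phi>] half_line_solution_forward_maximal[OF that(1)] that(2,3) r by auto
  have bound: "norm (\<phi> t) \<le> 1 / k" if "inclusion_solution ?G {0..} \<phi>" "N (\<phi> 0) \<le> r" "0 \<le> t" for \<phi> t
    using below1[OF that] k(2)[of "\<phi> t"] k(1) by (simp add: field_simps)
  have "0 \<le> 1 / k" using k(1) by simp
  then obtain C L where clock: "\<And>\<phi>. inclusion_solution ?G {0..} \<phi> \<Longrightarrow>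
      (\<And>t. 0 \<le> t \<Longrightarrow> norm (\<phi> t) \<le> 1 / k) \<Longrightarrow> \<exists>\<Lambda>. clocked_solution i A c C L \<phi> \<Lambda>"
    using inclusion_solution_imp_clocked_solution[OF N, of "1 / k" i A c] by metis
  obtain m :: nat where m: "\<not> (\<exists>\<phi> \<Lambda>. clocked_solution i A c C L \<phi> \<Lambda> \<and> N (\<phi> 0) \<le> r \<and>
      (\<forall>t\<ge>0. norm (\<phi> t) \<le> 1 / k) \<and> (\<forall>t. 0 \<le> t \<and> t \<le> real m \<longrightarrow> \<eta> \<le> N (\<phi> t)))"
  proof (rule ccontr)
    assume "\<not> thesis"
    then have approx: "\<exists>\<phi> \<Lambda>. clocked_solution i A c C L \<phi> \<Lambda> \<and> N (\<phi> 0) \<le> r \<and>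
      (\<forall>t\<ge>0. norm (\<phi> t) \<le> 1 / k) \<and> (\<forall>t. 0 \<le> t \<and> t \<le> real m \<longrightarrow> \<eta> \<le> N (\<phi> t))" for m :: nat
      using that by (rule contrapos_np)
    obtain \<phi> \<Lambda> where \<phi>: "clocked_solution i A c C L \<phi> \<Lambda>" "N (\<phi> 0) \<le> r"
      "\<forall>t\<ge>0. \<eta> \<le> N (\<phi> t)"
      using clocked_solutions_limit[OF N approx] by blast
    have "forward_maximal_solution ?G {0..} \<phi>"
      by (intro half_line_solution_forward_maximal clocked_solution_imp_inclusion_solution[OF N \<phi>(1)])
    then have "(\<phi> \<longlongrightarrow> 0) at_top" using attr[rule_format, of "{0..}" \<phi>] \<phi>(2) r by simp
    then have "((\<lambda>t. N (\<phi> t)) \<longlongrightarrow> N 0) at_top"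
      using is_norm_continuous[OF N, of UNIV]
      by (auto simp: continuous_on_eq_continuous_within intro: isCont_tendsto_compose)
    moreover have "\<forall>\<^sub>F t in at_top. \<eta> \<le> N (\<phi> t)"
      using eventually_ge_at_top[of 0] by eventually_elim (use \<phi>(3) in blast)
    ultimately have "\<eta> \<le> N 0" by (rule tendsto_lowerbound) simp
    then show False using \<open>0 < \<eta>\<close> is_norm_simps(2)[OF N] by simp
  qed
  have late: "N (\<phi> t) \<le> r / 2"
    if sol: "inclusion_solution ?G {0..} \<phi>" and start: "N (\<phi> 0) \<le> r" and t: "real m + 1 \<le> t" for \<phi> t
  proof -
    obtain \<Lambda> where "clocked_solution i A c C L \<phi> \<Lambda>"
      using clock[OF sol bound[OF sol start]] by blast
    then obtain a where a: "0 \<le> a" "a \<le> real m" "N (\<phi> a) < \<eta>"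
      using m bound[OF sol start] start by (meson not_le)
    have "forward_maximal_solution ?G {0..} (\<lambda>t. \<phi> (t + a))"
      by (rule half_line_solution_forward_maximal
          [OF inclusion_solution_shift[OF N sol bound[OF sol start] a(1)]])
    then have "\<forall>t\<ge>0. N (\<phi> (t + a)) < r / 2"
      using lyap\<eta>[rule_format, of "{0..}" "\<lambda>t. \<phi> (t + a)"] a(3) by simp
    from this[rule_format, of "t - a"] show ?thesis using a t by simp
  qed
  show ?thesis
  proof (rule that[of r "real m + 1"])
    show "\<forall>I \<phi>. forward_maximal_solution ?G I \<phi> \<and> 0 \<in> I \<and> N (\<phi> 0) < r \<longrightarrow> {0..} \<subseteq> I"
    proof (intro allI impI)
      fix I \<phi> assume "forward_maximal_solution ?G I \<phi> \<and> 0 \<in> I \<and> N (\<phi> 0) < r"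
      then show "{0..} \<subseteq> I" using lyap1[rule_format, of I \<phi>] r(2) by simp
    qed
    show "\<forall>\<phi>. inclusion_solution ?G {0..} \<phi> \<and> N (\<phi> 0) \<le> r \<longrightarrow>
        (\<forall>t\<ge>0. N (\<phi> t) \<le> 1) \<and> (\<forall>t\<ge>real m + 1. N (\<phi> t) \<le> r / 2)"
      using below1 late less_imp_le by metis
  qed (use r in auto)
qed

text \<open>
  A solution starting at size \<open>N (\<phi> 0) \<le> r\<close> is scaled up to size \<open>r\<close>, where the uniform estimates
  hold. Scaled back, they say that \<open>\<phi>\<close> is always at most \<open>N (\<phi> 0) / r\<close> and has halved after time \<open>T\<close>.
\<close>

lemma asymptotically_stable_imp_exponentially_stable:
  fixes A :: "real^'n^'n"
  assumes N: "is_norm N" and stable: "asymptotically_stable N (filippov_map N i (pws_field i A c)) 0"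
  shows "exponentially_stable N (filippov_map N i (pws_field i A c)) 0"
proof -
  let ?G = "filippov_map N i (pws_field i A c)"
  obtain r T where r: "0 < r" and T: "0 < T"
    and global: "\<forall>I \<phi>. forward_maximal_solution ?G I \<phi> \<and> 0 \<in> I \<and> N (\<phi> 0) < r \<longrightarrow> {0..} \<subseteq> I"
    and uniform: "\<forall>\<phi>. inclusion_solution ?G {0..} \<phi> \<and> N (\<phi> 0) \<le> r \<longrightarrow>
      (\<forall>t\<ge>0. N (\<phi> t) \<le> 1) \<and> (\<forall>t\<ge>T. N (\<phi> t) \<le> r / 2)"
    by (rule asymptotically_stable_uniform[OF N stable])
  have below1: "N (\<phi> t) \<le> 1" if "inclusion_solution ?G {0..} \<phi>" "N (\<phi> 0) \<le> r" "0 \<le> t" for \<phi> t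
    using uniform that by blast
  have late: "N (\<phi> t) \<le> r / 2" if "inclusion_solution ?G {0..} \<phi>" "N (\<phi> 0) \<le> r" "T \<le> t" for \<phi> t
    using uniform that by blast
  note nonneg = is_norm_simps(1)[OF N]
  obtain k where k: "k > 0" "\<And>x. k * norm x \<le> N x" using is_norm_bounded_below[OF N] by blast
  have bound: "norm (\<phi> t) \<le> 1 / k" if "inclusion_solution ?G {0..} \<phi>" "N (\<phi> 0) \<le> r" "0 \<le> t" for \<phi> t
    using below1[OF that] k(2)[of "\<phi> t"] k(1) by (simp add: field_simps)
  have scaled: "\<kappa> * N (\<phi> t) \<le> 1" "T \<le> t \<Longrightarrow> \<kappa> * N (\<phi> t) \<le> r / 2"
    if sol: "inclusion_solution ?G {0..} \<phi>" and start: "\<kappa> * N (\<phi> 0) \<le> r" and \<kappa>: "1 \<le> \<kappa>" and t: "0 \<le> t" for \<phi> \<kappa> t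
  proof -
    have "N (\<phi> 0) \<le> r" using start mult_right_mono[OF \<kappa> nonneg[of "\<phi> 0"]] by simp
    then obtain \<theta> \<psi> where s: "inclusion_solution ?G {0..} \<psi>" "\<psi> 0 = \<kappa> *\<^sub>R \<phi> 0"
      "\<And>t. 0 \<le> t \<Longrightarrow> t \<le> \<theta> t" "\<And>t. 0 \<le> t \<Longrightarrow> \<psi> (\<theta> t) = \<kappa> *\<^sub>R \<phi> t"
      using inclusion_solution_scale[OF N sol bound[OF sol] \<kappa>] by metis
    have \<psi>: "N (\<psi> 0) \<le> r" "N (\<psi> (\<theta> t)) = \<kappa> * N (\<phi> t)" "t \<le> \<theta> t"
      using s(2-4) start \<kappa> t by (simp_all add: is_norm_simps(3)[OF N])
    show "\<kappa> * N (\<phi> t) \<le> 1" using below1[OF s(1) \<psi>(1), of "\<theta> t"] \<psi> t by simp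
    show "\<kappa> * N (\<phi> t) \<le> r / 2" if "T \<le> t" using late[OF s(1) \<psi>(1), of "\<theta> t"] \<psi> that by simp
  qed
  have linear: "N (\<phi> t) \<le> N (\<phi> 0) / r" "T \<le> t \<Longrightarrow> N (\<phi> t) \<le> N (\<phi> 0) / 2"
    if sol: "inclusion_solution ?G {0..} \<phi>" and start: "N (\<phi> 0) \<le> r" and t: "0 \<le> t" for \<phi> t
  proof -
    have "N (\<phi> t) \<le> N (\<phi> 0) / r \<and> (T \<le> t \<longrightarrow> N (\<phi> t) \<le> N (\<phi> 0) / 2)"
    proof (cases "N (\<phi> 0) = 0")
      case True
      \<comment> \<open>a solution from the origin may be scaled by every factor and stays of size at most 1, so it vanishes\<close>
      have "N (\<phi> t) = 0"
      proof (rule ccontr)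
        assume "N (\<phi> t) \<noteq> 0"
        then have pos: "0 < N (\<phi> t)" using nonneg[of "\<phi> t"] by simp
        have "(1 + 2 / N (\<phi> t)) * N (\<phi> t) \<le> 1"
          using scaled(1)[OF sol, of "1 + 2 / N (\<phi> t)" t] True r t pos by simp
        moreover have "(1 + 2 / N (\<phi> t)) * N (\<phi> t) = N (\<phi> t) + 2"
          using pos by (simp add: field_simps)
        ultimately show False using pos by linarith
      qed
      then show ?thesis using True by simp
    next
      case False
      then have pos: "0 < N (\<phi> 0)" using nonneg[of "\<phi> 0"] by simp
      then show ?thesis
        using scaled[OF sol, of "r / N (\<phi> 0)" t] start t r by (auto simp: field_simps)
    qed
    then show "N (\<phi> t) \<le> N (\<phi> 0) / r" "T \<le> t \<Longrightarrow> N (\<phi> t) \<le> N (\<phi> 0) / 2" by auto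
  qed
  have geometric: "N (\<phi> t) \<le> N (\<phi> 0) / (r * 2 ^ j)"
    if "inclusion_solution ?G {0..} \<phi>" "N (\<phi> 0) \<le> r" "real j * T \<le> t" for \<phi> t j
    using that
  proof (induction j arbitrary: \<phi> t)
    case 0
    then show ?case using linear(1)[of \<phi> t] by simp
  next
    case (Suc j)
    have t: "real j * T \<le> t - T" using Suc.prems(3) by (simp add: algebra_simps)
    have half: "N (\<phi> T) \<le> N (\<phi> 0) / 2" using linear(2)[OF Suc.prems(1,2)] T by simp
    have "inclusion_solution ?G {0..} (\<lambda>t. \<phi> (t + T))"
      using T by (intro inclusion_solution_shift[OF N Suc.prems(1) bound[OF Suc.prems(1,2)]]) auto
    moreover have "N (\<phi> T) \<le> r" using half Suc.prems(2) nonneg[of "\<phi> 0"] by linarith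
    ultimately have "N (\<phi> t) \<le> N (\<phi> T) / (r * 2 ^ j)"
      using Suc.IH[of "\<lambda>t. \<phi> (t + T)" "t - T"] t by simp
    also have "\<dots> \<le> (N (\<phi> 0) / 2) / (r * 2 ^ j)" using half r by (intro divide_right_mono) auto
    finally show ?case by (simp add: mult_ac)
  qed
  define \<alpha> where "\<alpha> = max 1 (2 / r)"
  \<comment> \<open>halving per time \<open>T\<close>; the 2 in \<open>\<alpha>\<close> pays for rounding the number of periods down\<close>
  define \<beta> where "\<beta> = ln 2 / T"
  have decay: "N (\<phi> t) \<le> \<alpha> * exp (- \<beta> * t) * N (\<phi> 0)"
    if sol: "inclusion_solution ?G {0..} \<phi>" and start: "N (\<phi> 0) \<le> r" and t: "0 \<le> t" for \<phi> t
  proof -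
    define j where "j = nat \<lfloor>t / T\<rfloor>"
    have "0 \<le> t / T" using t T by simp
    then have j: "real j \<le> t / T" "t / T \<le> real (Suc j)" unfolding j_def by linarith+
    have "\<beta> * t \<le> real (Suc j) * ln 2"
      using mult_right_mono[OF j(2), of "ln 2"] by (simp add: \<beta>_def mult.commute)
    then have "exp (\<beta> * t) \<le> exp (real (Suc j) * ln 2)" by simp
    also have "\<dots> = 2 ^ Suc j" by (subst exp_of_nat_mult) simp
    finally have "1 / 2 ^ j \<le> 2 * exp (- \<beta> * t)" by (simp add: exp_minus field_simps)
    then have e: "1 / (r * 2 ^ j) \<le> 2 / r * exp (- \<beta> * t)" using r by (simp add: field_simps)
    have "N (\<phi> t) \<le> 1 / (r * 2 ^ j) * N (\<phi> 0)"
      using geometric[OF sol start, of j t] j(1) T by (simp add: field_simps)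
    also have "\<dots> \<le> (2 / r * exp (- \<beta> * t)) * N (\<phi> 0)"
      using e nonneg by (intro mult_right_mono) auto
    also have "\<dots> \<le> \<alpha> * exp (- \<beta> * t) * N (\<phi> 0)"
      using nonneg by (intro mult_right_mono) (auto simp: \<alpha>_def)
    finally show ?thesis .
  qed
  have maximal: "{0..} \<subseteq> I \<and> (\<forall>t\<ge>0. N (\<phi> t - 0) \<le> \<alpha> * exp (- \<beta> * t) * N (\<phi> 0 - 0))"
    if sol: "forward_maximal_solution ?G I \<phi>" "0 \<in> I" "\<phi> 0 \<in> norm_ball N 0 r" for I \<phi>
  proof -
    have start: "N (\<phi> 0) < r" using sol(3) by (simp add: norm_ball_def is_norm_simps(4)[OF N])
    then have I: "{0..} \<subseteq> I" using global sol by blast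
    have "inclusion_solution ?G {0..} \<phi>"
      by (rule forward_maximal_solution_on_half_line[OF sol(1) I])
    then show ?thesis using decay[of \<phi>] start I by simp
  qed
  have "1 \<le> \<alpha>" "0 < \<beta>" using T by (auto simp: \<alpha>_def \<beta>_def)
  then show ?thesis
    unfolding exponentially_stable_def using is_equilibrium_origin[OF N] r maximal by blast
qed

theorem theorem2p2:
  fixes N :: "real^'n \<Rightarrow> real"
    and i :: 'n
    and A :: "real^'n^'n"
    and c :: "real^'n"
  assumes "is_norm N"
  shows "exponentially_stable N (filippov_map N i (pws_field i A c)) 0 \<longleftrightarrow>
         asymptotically_stable N (filippov_map N i (pws_field i A c)) 0"
  using assms exponentially_stable_imp_asymptotically_stable
    asymptotically_stable_imp_exponentially_stable by blast

end
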